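(* Let $\beta>1$ be a real number. For any $\varepsilon>0$ there exist two positive constants $A$ and $\alpha$ (both depending only on $\beta$ and $\varepsilon$) such that for all $n\ge 1$, \[ \lambda\left\{x\in[0,1):\left|\frac{k_n(x)}{n}-\frac{6\log 2\log\beta}{\pi^2}\right|\ge\varepsilon\right\}\le A e^{-\alpha n}. \]
   Context: $\lambda$ is Lebesgue measure on $[0,1)$, $\log$ is the natural logarithm, and $[y]$ denotes the greatest integer not exceeding $y$. $\beta$-expansion: for real $\beta>1$ let $T_\beta:[0,1)\to[0,1)$, $T_\beta(x)=\beta x-[\beta x]$. The digits of $x\in[0,1)$ are $\varepsilon_1(x)=[\beta x]$ and $\varepsilon_{n+1}(x)=\varepsilon_1(T_\beta^n x)$ for $n\ge1$, so $x=\sum_{n\ge1}\varepsilon_n(x)\beta^{-n}$. For a block $(\varepsilon_1,\dots,\varepsilon_n)$ occurring as the first $n$ digits of some $x\in[0,1)$, the $n$-th cylinder is $J(\varepsilon_1,\dots,\varepsilon_n)=\{x\in[0,1):\varepsilon_i(x)=\varepsilon_i \text{ for all }1\le i\le n\}$. Continued fractions: let $T:[0,1)\to[0,1)$ be the Gauss transformation, $T(0)=0$ and $T(x)=1/x-[1/x]$ for $x\in(0,1)$. The partial quotients of an irrational $x\in[0,1)$ are $a_1(x)=[1/x]$, $a_{n+1}(x)=a_1(T^nx)$. For positive integers $a_1,\dots,a_m$, the $m$-th cylinder is $I(a_1,\dots,a_m)=\{x\in[0,1):a_1(x)=a_1,\dots,a_m(x)=a_m\}$ (for rational $x$, $a_j(x)$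 is defined by the same formula as long as $T^{j-1}x\neq0$, and points for which one of the required $a_j(x)$ is undefined do not belong to the set); for $m=0$ the cylinder is $[0,1)$. For irrational $x\in[0,1)$ and $n\ge1$, \[ k_n(x)=\sup\{m\ge0: J(\varepsilon_1(x),\dots,\varepsilon_n(x))\subseteq I(a_1(x),\dots,a_m(x))\}. \] Since $k_n(x)$ is defined only for irrational $x$, the set in the claim is understood as a set of irrational $x$ (rationals have Lebesgue measure zero). *)

theory Defs
  imports "HOL-Analysis.Analysis"
begin

definition beta_map :: "real \<Rightarrow> real \<Rightarrow> real" where
  "beta_map \<beta> x = \<beta> * x - of_int \<lfloor>\<beta> * x\<rfloor>"

(* Digits and partial quotients are indexed from 1, as usual; index 0 is never used. *)

definition beta_digit :: "real \<Rightarrow> nat \<Rightarrow> real \<Rightarrow> int" where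
  "beta_digit \<beta> i x = \<lfloor>\<beta> * (beta_map \<beta> ^^ (i - 1)) x\<rfloor>"

definition beta_cylinder :: "real \<Rightarrow> nat \<Rightarrow> (nat \<Rightarrow> int) \<Rightarrow> real set" where
  "beta_cylinder \<beta> n e = {x \<in> {0..<1}. \<forall>i\<in>{1..n}. beta_digit \<beta> i x = e i}"

definition gauss_map :: "real \<Rightarrow> real" where
  "gauss_map x = (if x = 0 then 0 else 1 / x - of_int \<lfloor>1 / x\<rfloor>)"

definition cf_quot :: "nat \<Rightarrow> real \<Rightarrow> int" where
  "cf_quot j x = \<lfloor>1 / (gauss_map ^^ (j - 1)) x\<rfloor>"

(* The j-th partial quotient of x exists only if the (j-1)-st iterate of the Gauss map at x is
   nonzero; points with a missing partial quotient are excluded from the cylinder. *)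

definition cf_cylinder :: "nat \<Rightarrow> (nat \<Rightarrow> int) \<Rightarrow> real set" where
  "cf_cylinder m a =
     {x \<in> {0..<1}. \<forall>j\<in>{1..m}. (gauss_map ^^ (j - 1)) x \<noteq> 0 \<and> cf_quot j x = a j}"

(* For irrational x in [0,1) and \<beta> > 1 the supremum is over a finite set containing 0: the
   \<beta>-cylinder of x is a nondegenerate interval, while the lengths of the continued fraction
   cylinders of x tend to 0. So the supremum in nat is the intended one. *)

definition cf_digits_known :: "real \<Rightarrow> nat \<Rightarrow> real \<Rightarrow> nat" where
  "cf_digits_known \<beta> n x =
     Sup {m. beta_cylinder \<beta> n (\<lambda>i. beta_digit \<beta> i x) \<subseteq> cf_cylinder m (\<lambda>j. cf_quot j x)}"

(* x ranges over irrationals only, since the partial quotients are needed for all indices. *)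

definition deviation_set :: "real \<Rightarrow> real \<Rightarrow> nat \<Rightarrow> real set" where
  "deviation_set \<beta> \<epsilon> n =
     {x \<in> {0..<1} - \<rat>.
        \<bar>real (cf_digits_known \<beta> n x) / real n - 6 * ln 2 * ln \<beta> / pi\<^sup>2\<bar> \<ge> \<epsilon>}"

end

theory Submission
  imports Defs "HOL-Real_Asymp.Real_Asymp"
begin

text \<open>
  Let \<open>T\<close> be the Gauss map, \<open>D\<^sub>m(x) = x \<cdot> T x \<cdots> T\<^sup>m\<^sup>-\<^sup>1 x\<close> and \<open>S\<^sub>m = - ln D\<^sub>m\<close>. Two points with the same first
  \<open>m\<close> partial quotients satisfy \<open>|x - y| = D\<^sub>m(x) D\<^sub>m(y) |T\<^sup>m x - T\<^sup>m y|\<close>, and \<open>D\<^sub>m\<close> varies by at most a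
  factor 2 on a cylinder, so the \<open>m\<close>-th continued fraction cylinder around \<open>x\<close> has size about
  \<open>D\<^sub>m(x)\<^sup>2 = exp (- 2 S\<^sub>m(x))\<close>. The \<open>n\<close>-th \<open>\<beta>\<close>-cylinder around \<open>x\<close> has length at most \<open>\<beta>\<^sup>-\<^sup>n\<close>, and at least
  \<open>exp (- \<delta> n) \<beta>\<^sup>-\<^sup>n\<close> unless \<open>T\<^sub>\<beta>\<^sup>n x < exp (- \<delta> n)\<close>, an event of exponentially small measure. Hence
  \<open>k\<^sub>n(x)\<close> is essentially the largest \<open>m\<close> with \<open>2 S\<^sub>m(x) \<le> n ln \<beta>\<close>, except where some \<open>T\<^sup>j x\<close> with \<open>j \<le> m\<close> is
  exponentially close to 0 or 1, and it remains to prove that \<open>S\<^sub>m / m\<close> deviates from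
  \<open>\<gamma> = \<pi>\<^sup>2 / (12 ln 2)\<close> with exponentially small probability.

  The transfer operator \<open>L\<close> of \<open>T\<close> with respect to the Gauss measure contracts Lipschitz constants by
  \<open>7/8\<close>, so \<open>L\<^sup>n (- ln)\<close> converges uniformly to \<open>\<gamma>\<close>, the mean of \<open>- ln\<close>. This gives a bounded \<open>u\<close> with
  \<open>L (- ln - \<gamma> + u) \<approx> u\<close>, whence \<open>L (exp (t (- ln - \<gamma> + u))) \<le> exp (|t| \<delta>) exp (t u)\<close> for small \<open>|t|\<close>.
  Iterating, \<open>exp (t (S\<^sub>m - \<gamma> m))\<close> has integral at most \<open>C exp (|t| \<delta> m)\<close>, and Chernoff's bound applies.
\<close>

section \<open>Geometry of continued fraction cylinders\<close>

lemma gauss_map_frac: "x \<noteq> 0 \<Longrightarrow> gauss_map x = frac (1 / x)"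
  by (simp add: gauss_map_def frac_def)

lemma gauss_map_range: "0 \<le> gauss_map x \<and> gauss_map x < 1"
  by (cases "x = 0") (simp_all add: gauss_map_frac frac_lt_1, simp add: gauss_map_def)

lemma gauss_iter_range: "x \<in> {0..<1} \<Longrightarrow> (gauss_map ^^ n) x \<in> {0..<1}"
  using gauss_map_range by (cases n) auto

lemma gauss_map_irrational:
  assumes "x \<notin> \<rat>" shows "gauss_map x \<notin> \<rat>"
proof
  assume r: "gauss_map x \<in> \<rat>"
  have "x \<noteq> 0" using assms by auto
  then have "1 / x = gauss_map x + of_int \<lfloor>1 / x\<rfloor>" by (simp add: gauss_map_def)
  then have "1 / x \<in> \<rat>" using r by (metis Rats_add Rats_of_int)
  then have "1 / (1 / x) \<in> \<rat>" by (metis Rats_1 Rats_divide)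
  then show False using assms by simp
qed

lemma gauss_iter_irrational: "x \<notin> \<rat> \<Longrightarrow> (gauss_map ^^ n) x \<notin> \<rat>"
  by (induction n) (auto simp: gauss_map_irrational)

lemma gauss_iter_pos:
  assumes "x \<in> {0..<1}" "x \<notin> \<rat>" shows "0 < (gauss_map ^^ n) x"
  using gauss_iter_range[OF assms(1), of n] gauss_iter_irrational[OF assms(2), of n]
  by (metis Rats_0 atLeastLessThan_iff less_eq_real_def)

lemma inverse_gauss_eq: "x \<noteq> 0 \<Longrightarrow> x * (of_int \<lfloor>1 / x\<rfloor> + gauss_map x) = 1"
  by (simp add: gauss_map_def)

lemma floor_inverse_ge_1: "0 < x \<Longrightarrow> x < 1 \<Longrightarrow> 1 \<le> \<lfloor>1 / x\<rfloor>" for x :: real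
  by simp

section \<open>Products along an orbit and the size of a cylinder\<close>

definition orbit_prod :: "nat \<Rightarrow> real \<Rightarrow> real" where
  "orbit_prod m x = (\<Prod>i<m. (gauss_map ^^ i) x)"

text \<open>A symmetric form of lying in a common cylinder of order \<open>m\<close>, indexed from
  0, so that the estimates below can start from either point. Nonvanishing is demanded because, with
  \<open>1 / 0 = 0\<close>, two points whose expansions have ended would otherwise go on
  agreeing.\<close>

definition cf_agree :: "nat \<Rightarrow> real \<Rightarrow> real \<Rightarrow> bool" where
  "cf_agree m x y \<longleftrightarrow> (\<forall>i<m. (gauss_map ^^ i) x \<noteq> 0 \<and> (gauss_map ^^ i) y \<noteq> 0 \<and>
     \<lfloor>1 / (gauss_map ^^ i) x\<rfloor> = \<lfloor>1 / (gauss_map ^^ i) y\<rfloor>)"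

lemma cf_agree_Suc: "cf_agree (Suc m) x y \<longleftrightarrow> cf_agree m x y \<and>
    (gauss_map ^^ m) x \<noteq> 0 \<and> (gauss_map ^^ m) y \<noteq> 0 \<and>
    \<lfloor>1 / (gauss_map ^^ m) x\<rfloor> = \<lfloor>1 / (gauss_map ^^ m) y\<rfloor>"
  by (auto simp: cf_agree_def less_Suc_eq)

lemma cf_cylinder_iff:
  assumes "x \<in> {0..<1}" "x \<notin> \<rat>"
  shows "y \<in> cf_cylinder m (\<lambda>j. cf_quot j x) \<longleftrightarrow> y \<in> {0..<1} \<and> cf_agree m x y"
proof -
  have *: "(\<forall>j\<in>{1..m}. P (j - 1)) \<longleftrightarrow> (\<forall>i<m. P i)" for P :: "nat \<Rightarrow> bool"
  proof (intro iffI allI impI ballI)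
    fix i assume "\<forall>j\<in>{1..m}. P (j - 1)" "i < m"
    then show "P i" by (metis Suc_leI atLeastAtMost_iff diff_Suc_1 le_add1 plus_1_eq_Suc)
  qed auto
  have "(gauss_map ^^ i) x \<noteq> 0" for i using gauss_iter_pos[OF assms, of i] by simp
  then show ?thesis
    using *[of "\<lambda>i. (gauss_map ^^ i) y \<noteq> 0 \<and> \<lfloor>1 / (gauss_map ^^ i) y\<rfloor> = \<lfloor>1 / (gauss_map ^^ i) x\<rfloor>"]
    unfolding cf_cylinder_def cf_agree_def cf_quot_def by auto
qed

(* q and q' are the denominators of the convergents of orders m and m - 1. *)
lemma cf_agree_denominators:
  assumes "x \<in> {0..<1}" "y \<in> {0..<1}" "cf_agree m x y"
  shows "\<exists>q q'. 0 \<le> q' \<and> q' \<le> q \<and> 0 < q \<and>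
     orbit_prod m x * (q + q' * (gauss_map ^^ m) x) = 1 \<and>
     orbit_prod m y * (q + q' * (gauss_map ^^ m) y) = 1"
  using assms(3)
proof (induction m)
  case 0
  show ?case by (rule exI[of _ 1], rule exI[of _ 0]) (simp add: orbit_prod_def)
next
  case (Suc m)
  then have ag: "cf_agree m x y" by (simp add: cf_agree_Suc)
  obtain q q' where q: "0 \<le> q'" "q' \<le> q" "0 < q"
     "orbit_prod m x * (q + q' * (gauss_map ^^ m) x) = 1"
     "orbit_prod m y * (q + q' * (gauss_map ^^ m) y) = 1"
    using Suc.IH[OF ag] by blast
  let ?u = "(gauss_map ^^ m) x" and ?v = "(gauss_map ^^ m) y"
  define a where "a = real_of_int \<lfloor>1 / ?u\<rfloor>"
  have nz: "?u \<noteq> 0" "?v \<noteq> 0" and a': "a = real_of_int \<lfloor>1 / ?v\<rfloor>"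
    using Suc.prems by (auto simp: cf_agree_Suc a_def)
  have "1 \<le> \<lfloor>1 / ?u\<rfloor>" using gauss_iter_range[OF assms(1), of m] nz(1)
    by (intro floor_inverse_ge_1) auto
  then have a1: "1 \<le> a" by (simp add: a_def)
  have u: "?u * (a + gauss_map ?u) = 1" using inverse_gauss_eq[OF nz(1)] by (simp add: a_def)
  have v: "?v * (a + gauss_map ?v) = 1" using inverse_gauss_eq[OF nz(2)] by (simp add: a')
  \<comment> \<open>The recurrence of the denominators: the next partial quotient \<open>a\<close>
    turns \<open>(q, q')\<close> into \<open>(q * a + q', q)\<close>, and extending the product
    \<open>D\<close> by the factor \<open>w\<close> preserves the identity.\<close>
  have *: "D * w * (q * a + q' + q * s) = 1" if "w * (a + s) = 1" "D * (q + q' * w) = 1" for D w s :: real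
  proof -
    have "D * w * (q * a + q' + q * s) = D * (q * (w * (a + s)) + q' * w)" by (simp add: algebra_simps)
    then show ?thesis using that by simp
  qed
  have "q \<le> q * a + q'" using a1 q by (metis add.right_neutral add_mono mult.right_neutral mult_left_mono less_imp_le)
  moreover have "orbit_prod (Suc m) x * (q * a + q' + q * (gauss_map ^^ Suc m) x) = 1"
    using *[OF u q(4)] by (simp add: orbit_prod_def mult.assoc)
  moreover have "orbit_prod (Suc m) y * (q * a + q' + q * (gauss_map ^^ Suc m) y) = 1"
    using *[OF v q(5)] by (simp add: orbit_prod_def mult.assoc)
  ultimately show ?case using q by (intro exI[of _ "q * a + q'"] exI[of _ q]) auto
qed

lemma cf_agree_sym: "cf_agree m x y \<Longrightarrow> cf_agree m y x"
  by (simp add: cf_agree_def)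

lemma orbit_prod_nonneg: "x \<in> {0..<1} \<Longrightarrow> 0 \<le> orbit_prod m x"
  unfolding orbit_prod_def using gauss_iter_range by (intro prod_nonneg) auto

text \<open>Both products are reciprocals of numbers \<open>q + q' * z\<close> with the same
  \<open>q' \<le> q\<close> and with \<open>z\<close> in \<open>{0..<1}\<close>, hence of numbers
  between \<open>q\<close> and \<open>2 * q\<close>.\<close>

lemma orbit_prod_le_2:
  assumes "x \<in> {0..<1}" "y \<in> {0..<1}" "cf_agree m x y"
  shows "orbit_prod m y \<le> 2 * orbit_prod m x"
proof -
  obtain q q' where q: "0 \<le> q'" "q' \<le> q" "0 < q"
     "orbit_prod m x * (q + q' * (gauss_map ^^ m) x) = 1"
     "orbit_prod m y * (q + q' * (gauss_map ^^ m) y) = 1"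
    using cf_agree_denominators[OF assms] by blast
  let ?u = "(gauss_map ^^ m) x" and ?v = "(gauss_map ^^ m) y"
  have uv: "0 \<le> ?u" "?u < 1" "0 \<le> ?v" "?v < 1"
    using gauss_iter_range[OF assms(1), of m] gauss_iter_range[OF assms(2), of m] by auto
  have "q' * ?u \<le> q" using q uv by (metis less_imp_le mult_left_le order_trans)
  moreover have "0 \<le> q' * ?v" using q uv by simp
  ultimately have le: "q + q' * ?u \<le> 2 * (q + q' * ?v)" unfolding distrib_left by linarith
  have "orbit_prod m y = orbit_prod m y * (orbit_prod m x * (q + q' * ?u))" using q by simp
  also have "\<dots> \<le> orbit_prod m y * (orbit_prod m x * (2 * (q + q' * ?v)))"
    using le orbit_prod_nonneg assms by (intro mult_left_mono) auto
  also have "\<dots> = 2 * orbit_prod m x * (orbit_prod m y * (q + q' * ?v))" by (simp add: algebra_simps)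
  finally show ?thesis using q by simp
qed

text \<open>On a common branch, \<open>u = 1 / (a + s)\<close> and \<open>v = 1 / (a + r)\<close>
  give \<open>u - v = u * v * (r - s)\<close>. Iterating collects the two products; the alternating
  sign disappears in the absolute value.\<close>

lemma abs_diff_cf_agree:
  assumes "cf_agree m x y"
  shows "\<bar>x - y\<bar> = \<bar>orbit_prod m x * orbit_prod m y * ((gauss_map ^^ m) x - (gauss_map ^^ m) y)\<bar>"
  using assms
proof (induction m)
  case 0 then show ?case by (simp add: orbit_prod_def)
next
  case (Suc m)
  let ?u = "(gauss_map ^^ m) x" and ?v = "(gauss_map ^^ m) y"
  define a where "a = real_of_int \<lfloor>1 / ?u\<rfloor>"
  have nz: "?u \<noteq> 0" "?v \<noteq> 0" and a': "a = real_of_int \<lfloor>1 / ?v\<rfloor>"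
    using Suc.prems by (auto simp: cf_agree_Suc a_def)
  have u: "?u * (a + gauss_map ?u) = 1" using inverse_gauss_eq[OF nz(1)] by (simp add: a_def)
  have v: "?v * (a + gauss_map ?v) = 1" using inverse_gauss_eq[OF nz(2)] by (simp add: a')
  have *: "?u - ?v = ?u * ?v * (gauss_map ?v - gauss_map ?u)"
  proof -
    have "?u = ?u * (?v * (a + gauss_map ?v))" "?v = ?v * (?u * (a + gauss_map ?u))" using u v by simp_all
    then show ?thesis by (simp add: algebra_simps)
  qed
  have "\<bar>x - y\<bar> = \<bar>orbit_prod m x * orbit_prod m y * (?u - ?v)\<bar>"
    using Suc by (simp add: cf_agree_Suc)
  also have "\<dots> = \<bar>orbit_prod (Suc m) x * orbit_prod (Suc m) y * (gauss_map ?v - gauss_map ?u)\<bar>"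
    by (subst *) (simp add: orbit_prod_def ac_simps)
  also have "\<dots> = \<bar>orbit_prod (Suc m) x * orbit_prod (Suc m) y * (gauss_map ?u - gauss_map ?v)\<bar>"
    by (simp add: abs_mult abs_minus_commute)
  finally show ?case by simp
qed

lemma abs_diff_cf_agree_le:
  assumes "x \<in> {0..<1}" "y \<in> {0..<1}" "cf_agree m x y"
  shows "\<bar>x - y\<bar> \<le> 2 * (orbit_prod m x)\<^sup>2"
proof -
  have "\<bar>(gauss_map ^^ m) x - (gauss_map ^^ m) y\<bar> \<le> 1"
    using gauss_iter_range[OF assms(1), of m] gauss_iter_range[OF assms(2), of m] by auto
  then have "\<bar>x - y\<bar> \<le> orbit_prod m x * orbit_prod m y * 1"
    unfolding abs_diff_cf_agree[OF assms(3)] abs_mult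
    using orbit_prod_nonneg assms by (intro mult_mono) auto
  also have "\<dots> \<le> orbit_prod m x * (2 * orbit_prod m x)"
    using orbit_prod_le_2[OF assms] orbit_prod_nonneg[OF assms(1), of m] by (auto intro: mult_left_mono)
  finally show ?thesis by (simp add: power2_eq_square)
qed

lemma orbit_prod_antimono:
  assumes "x \<in> {0..<1}" "i \<le> j" shows "orbit_prod j x \<le> orbit_prod i x"
proof -
  have "orbit_prod (i + k) x \<le> orbit_prod i x" for k
  proof (induction k)
    case (Suc k)
    have "orbit_prod (i + Suc k) x \<le> orbit_prod (i + k) x"
      using gauss_iter_range[OF assms(1), of "i + k"] orbit_prod_nonneg[OF assms(1), of "i + k"]
      by (simp add: orbit_prod_def mult_left_le)
    then show ?case using Suc by linarith
  qed simp
  from this[of "j - i"] assms show ?thesis by simp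
qed

text \<open>At the first step \<open>i\<close> where the partial quotients differ, the iterate of
  \<open>z\<close> is outside the branch interval that contains the iterate of \<open>x\<close>. The
  next iterate of \<open>x\<close> keeps the distance \<open>\<eta>\<close> from 0 and 1, so the
  iterate of \<open>x\<close> is well inside this interval, and \<open>abs_diff_cf_agree\<close>
  carries the gap back to \<open>x\<close> and \<open>z\<close>.\<close>

lemma abs_diff_not_cf_agree_ge:
  assumes x: "x \<in> {0..<1}" "x \<notin> \<rat>" and z: "z \<in> {0..<1}" and "\<not> cf_agree m x z" and "0 < \<eta>"
    and far: "\<And>j. j \<le> m \<Longrightarrow> \<eta> \<le> (gauss_map ^^ j) x \<and> (gauss_map ^^ j) x \<le> 1 - \<eta>"
  shows "(orbit_prod m x)\<^sup>2 * \<eta> / 4 \<le> \<bar>x - z\<bar>"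
proof -
  have "\<exists>i<m. cf_agree i x z \<and> \<not> cf_agree (Suc i) x z"
    using assms(4)
  proof (induction m)
    case 0 then show ?case by (simp add: cf_agree_def)
  next
    case (Suc m) then show ?case by (cases "cf_agree m x z") (auto simp: less_Suc_eq)
  qed
  then obtain i where i: "i < m" "cf_agree i x z" "\<not> cf_agree (Suc i) x z" by blast
  let ?u = "(gauss_map ^^ i) x" and ?v = "(gauss_map ^^ i) z" and ?s = "(gauss_map ^^ Suc i) x"
  define a where "a = real_of_int \<lfloor>1 / ?u\<rfloor>"
  have u: "0 < ?u" "?u < 1" using gauss_iter_pos[OF x, of i] gauss_iter_range[OF x(1), of i] by auto
  have v: "0 \<le> ?v" "?v < 1" using gauss_iter_range[OF z, of i] by auto
  have s: "\<eta> \<le> ?s" "?s \<le> 1 - \<eta>" using far[of "Suc i"] i(1) by auto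
  have a1: "1 \<le> a" using floor_inverse_ge_1[OF u] by (simp add: a_def)
  have us: "?u * (a + ?s) = 1" using inverse_gauss_eq[of ?u] u by (simp add: a_def)
  \<comment> \<open>The quotient \<open>a\<close> is taken exactly between
    \<open>1 / (a + 1)\<close>, excluded, and \<open>1 / a\<close>, included.\<close>
  have vout: "?v \<le> 1 / (a + 1) \<or> 1 / a < ?v"
  proof (rule ccontr)
    assume "\<not> ?thesis"
    then have h: "1 / (a + 1) < ?v" "?v \<le> 1 / a" by auto
    have "?v > 0" using h(1) a1 by (smt (verit) divide_pos_pos)
    have "1 / ?v < a + 1" "a \<le> 1 / ?v" using h \<open>?v > 0\<close> a1 by (simp_all add: field_simps)
    then have "\<lfloor>1 / ?v\<rfloor> = \<lfloor>1 / ?u\<rfloor>" by (simp add: a_def floor_eq_iff)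
    then show False using i u \<open>?v > 0\<close> by (simp add: cf_agree_Suc)
  qed
  have ueq: "?u = 1 / (a + ?s)" using us u by (metis nonzero_divide_eq_eq less_numeral_extra(3) mult_zero_right zero_neq_one)
  have uw: "w / (a + ?s) = ?u * w" for w 
  proof -
    have "a + ?s \<noteq> 0" using us by auto
    moreover have "w = ?u * (a + ?s) * w" using us by simp
    ultimately show ?thesis by (metis mult.assoc mult.commute nonzero_eq_divide_eq)
  qed
  have pos: "0 < a + ?s" "?s < 1" "0 < ?s" using a1 s \<open>0 < \<eta>\<close> by auto
  have "?u\<^sup>2 * \<eta> / 2 \<le> \<bar>?u - ?v\<bar>"
  proof (cases "1 / a < ?v")
    case True
    have "?u\<^sup>2 * \<eta> / 2 \<le> ?u\<^sup>2 * \<eta>" using \<open>0 < \<eta>\<close> by simp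
    also have "?u\<^sup>2 * \<eta> \<le> ?u\<^sup>2 * ?s" using s by (intro mult_left_mono) auto
    also have "\<dots> = ?u * (?s / (a + ?s))" unfolding uw by (simp add: power2_eq_square)
    also have "\<dots> \<le> ?u * (?s / a)" using u pos a1 by (intro mult_left_mono divide_left_mono) auto
    also have "\<dots> = 1 / a - ?u" using ueq pos a1 by (simp add: field_simps)
    finally show ?thesis using True by linarith
  next
    case False
    then have v: "?v \<le> 1 / (a + 1)" using vout by blast
    have "?u\<^sup>2 * \<eta> / 2 = ?u * (\<eta> / 2 / (a + ?s))" unfolding uw by (simp add: power2_eq_square)
    also have "\<dots> = ?u * (\<eta> / (2 * (a + ?s)))" by simp
    \<comment> \<open>Here \<open>a + 1 \<le> 2 * (a + ?s)\<close> because \<open>a\<close> is at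
      least 1; this is why the gap carries a factor 1/2.\<close>
    also have "\<dots> \<le> ?u * ((1 - ?s) / (a + 1))" using u pos a1 s \<open>0 < \<eta>\<close>
      by (intro mult_left_mono frac_le) auto
    also have "\<dots> = ?u - 1 / (a + 1)" using ueq pos a1 by (simp add: field_simps)
    finally show ?thesis using v by linarith
  qed
  then have uv: "?u\<^sup>2 * \<eta> / 2 \<le> \<bar>?u - ?v\<bar>" .
  have D: "orbit_prod i x \<le> 2 * orbit_prod i z" using orbit_prod_le_2[OF z x(1) cf_agree_sym[OF i(2)]] .
  have nn: "0 \<le> orbit_prod k w" if "w \<in> {0..<1}" for k w using orbit_prod_nonneg that by blast
  \<comment> \<open>Of the factor 4, one 2 comes from the gap and the other from replacing
    \<open>orbit_prod i z\<close> by \<open>orbit_prod i x\<close>.\<close>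
  have "(orbit_prod m x)\<^sup>2 * \<eta> / 4 \<le> (orbit_prod (Suc i) x)\<^sup>2 * \<eta> / 4"
    using orbit_prod_antimono[OF x(1), of "Suc i" m] i(1) nn[OF x(1)] \<open>0 < \<eta>\<close>
    by (intro divide_right_mono mult_right_mono power_mono) auto
  also have "\<dots> = orbit_prod i x * (orbit_prod i x / 2) * (?u\<^sup>2 * \<eta> / 2)"
    by (simp add: orbit_prod_def power2_eq_square)
  also have "\<dots> \<le> orbit_prod i x * orbit_prod i z * \<bar>?u - ?v\<bar>"
    using uv D nn x(1) z \<open>0 < \<eta>\<close> by (intro mult_mono mult_nonneg_nonneg) auto
  also have "\<dots> = \<bar>x - z\<bar>"
    unfolding abs_diff_cf_agree[OF i(2)] using nn x(1) z by (simp add: abs_mult)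
  finally show ?thesis .
qed

text \<open>Two consecutive iterates have product at most 1/2: they satisfy
  \<open>?u * a + ?u * gauss_map ?u = 1\<close> with \<open>a\<close> at least 1, so the first
  summand is the larger one. The resulting shrinking of the cylinders makes
  \<open>cf_digits_known\<close> a true maximum.\<close>

lemma orbit_prod_even_le:
  assumes x: "x \<in> {0..<1}" shows "orbit_prod (2 * m) x \<le> (1 / 2) ^ m"
proof (induction m)
  case 0 show ?case by (simp add: orbit_prod_def)
next
  case (Suc m)
  let ?u = "(gauss_map ^^ (2 * m)) x"
  have u: "0 \<le> ?u" "?u < 1" using gauss_iter_range[OF x, of "2 * m"] by auto
  have "?u * gauss_map ?u \<le> 1 / 2"
  proof (cases "?u = 0")
    case False
    then have "1 \<le> \<lfloor>1 / ?u\<rfloor>" using floor_inverse_ge_1[of ?u] u by auto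
    then have "1 \<le> real_of_int \<lfloor>1 / ?u\<rfloor>" by simp
    then have "?u * 1 \<le> ?u * of_int \<lfloor>1 / ?u\<rfloor>" by (rule mult_left_mono[OF _ u(1)])
    moreover have "?u * gauss_map ?u \<le> ?u * 1"
      using gauss_map_range[of ?u] u by (intro mult_left_mono) auto
    ultimately show ?thesis using inverse_gauss_eq[OF False] by (simp add: distrib_left)
  qed simp
  moreover have "0 \<le> ?u * gauss_map ?u" using gauss_map_range[of ?u] u by simp
  ultimately have "orbit_prod (2 * m) x * (?u * gauss_map ?u) \<le> (1 / 2) ^ m * (1 / 2)"
    using Suc by (intro mult_mono) auto
  then show ?case by (simp add: orbit_prod_def mult.assoc)
qed

section \<open>The transfer operator of the Gauss map\<close>

(* The branches x = 1 / (y + k + 1) of the inverse of the Gauss map are numbered from k = 0. *)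
definition gauss_weight :: "nat \<Rightarrow> real \<Rightarrow> real" where
  "gauss_weight k x = (1 + x) / ((x + real k + 1) * (x + real k + 2))"

text \<open>A sum over the preimages of \<open>x\<close>, with weights of total 1, so that constants
  are fixed. The series is known to converge for \<open>tame\<close> functions and \<open>x\<close>
  in \<open>{0..1}\<close>.\<close>

definition gauss_transfer :: "(real \<Rightarrow> real) \<Rightarrow> real \<Rightarrow> real" where
  "gauss_transfer g x = (\<Sum>k. gauss_weight k x * g (1 / (x + real k + 1)))"

lemma gauss_weight_nonneg: "0 \<le> x \<Longrightarrow> 0 \<le> gauss_weight k x"
  by (simp add: gauss_weight_def)

text \<open>The weights telescope. Besides the total weight 1, the closed form yields the estimate
  of how the weights depend on \<open>x\<close>, through their partial sums.\<close>

lemma sum_gauss_weight: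
  assumes "0 \<le> x" shows "(\<Sum>k<n. gauss_weight k x) = real n / (x + real n + 1)"
proof (induction n)
  case (Suc n)
  have "x + real n + 1 \<noteq> 0" "x + real n + 2 \<noteq> 0" using assms by linarith+
  then have "real n / (x + real n + 1) + gauss_weight n x = (real n + 1) / (x + real n + 2)"
    unfolding gauss_weight_def by (simp add: divide_simps) (simp add: algebra_simps)
  then show ?case using Suc by (simp add: ac_simps)
qed simp

lemma gauss_weight_sums: "0 \<le> x \<Longrightarrow> (\<lambda>k. gauss_weight k x) sums 1"
  unfolding sums_def by (simp add: sum_gauss_weight) real_asymp

text \<open>The weights decay like the inverse square of \<open>k\<close>; growth of order square
  root still leaves the summable exponent 3/2, uniformly in \<open>x\<close>.\<close>

lemma gauss_weight_sqrt_le: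
  assumes "0 \<le> x" "x \<le> 1"
  shows "gauss_weight k x * sqrt (x + real k + 1) \<le> 2 / (real k + 1) powr (3 / 2)"
proof -
  let ?s = "x + real k + 1"
  have pos: "0 < ?s" using assms by linarith
  have "gauss_weight k x * sqrt ?s \<le> 2 / (?s * ?s) * sqrt ?s"
    unfolding gauss_weight_def using assms
    by (intro mult_right_mono frac_le mult_mono mult_pos_pos) auto
  also have "?s * ?s = ?s powr (3 / 2) * sqrt ?s"
    using pos by (simp add: powr_half_sqrt[symmetric] powr_add[symmetric] power2_eq_square[symmetric])
  also have "2 / (?s powr (3 / 2) * sqrt ?s) * sqrt ?s = 2 / ?s powr (3 / 2)"
    using pos by simp
  also have "\<dots> \<le> 2 / (real k + 1) powr (3 / 2)"
    using assms by (intro divide_left_mono powr_mono2) auto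
  finally show ?thesis .
qed

lemma summable_powr_three_halves: "summable (\<lambda>k. C / (real k + 1) powr (3 / 2))"
proof -
  have "summable (\<lambda>k. real k powr (- (3 / 2)))" by (subst summable_real_powr_iff) simp
  then have "summable (\<lambda>k. real (Suc k) powr (- (3 / 2)))"
    by (rule summable_Suc_iff[THEN iffD2])
  then have "summable (\<lambda>k. C * real (Suc k) powr (- (3 / 2)))" by (rule summable_mult)
  then show ?thesis
    by (simp only: powr_minus_divide of_nat_Suc add.commute times_divide_eq_right mult_1_right)
qed

(* Dominated by z powr (-1/2): a class containing the bounded functions and - ln. *)
definition tame :: "real \<Rightarrow> (real \<Rightarrow> real) \<Rightarrow> bool" where
  "tame B g \<longleftrightarrow> (\<forall>s\<ge>1. \<bar>g (1 / s)\<bar> \<le> B * sqrt s)"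

lemma summable_gauss_transfer:
  assumes "tame B g" "0 \<le> x" "x \<le> 1"
  shows "summable (\<lambda>k. gauss_weight k x * g (1 / (x + real k + 1)))"
proof (rule summable_comparison_test')
  show "summable (\<lambda>k. B * 2 / (real k + 1) powr (3 / 2))" by (rule summable_powr_three_halves)
  fix k :: nat
  have "\<bar>g (1 / 1)\<bar> \<le> B * sqrt 1" using assms(1) unfolding tame_def by blast
  then have "0 \<le> B" by simp
  have "norm (gauss_weight k x * g (1 / (x + real k + 1))) \<le> gauss_weight k x * (B * sqrt (x + real k + 1))"
    using assms by (auto simp: abs_mult gauss_weight_nonneg tame_def intro!: mult_left_mono)
  also have "\<dots> = B * (gauss_weight k x * sqrt (x + real k + 1))" by simp
  also have "\<dots> \<le> B * (2 / (real k + 1) powr (3 / 2))"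
    using gauss_weight_sqrt_le assms \<open>0 \<le> B\<close> by (intro mult_left_mono) auto
  finally show "norm (gauss_weight k x * g (1 / (x + real k + 1))) \<le> B * 2 / (real k + 1) powr (3 / 2)"
    by simp
qed

section \<open>Lipschitz estimates for the transfer operator\<close>

lemma sum_by_parts:
  fixes D a :: "nat \<Rightarrow> real"
  assumes "D 0 = 0"
  shows "(\<Sum>k<n. (D (Suc k) - D k) * a k) = D n * a n - (\<Sum>k<n. D (Suc k) * (a (Suc k) - a k))"
  by (induction n) (auto simp: assms algebra_simps)

text \<open>The difference splits into a change of the values of \<open>g\<close>, weighted at
  \<open>y\<close>, and a change of the weights. The second part is summed by parts, so that
  \<open>g\<close> enters only through differences \<open>v\<close> between neighbouring branches,
  which stay small even for the unbounded \<open>- ln\<close>. The factor next to \<open>v k\<close>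
  bounds the change of the partial sums of the weights per unit of
  \<open>\<bar>x - y\<bar>\<close>.\<close>

lemma gauss_transfer_abs_diff_le:
  assumes t: "tame B g" and x: "0 \<le> x" "x \<le> 1" and y: "0 \<le> y" "y \<le> 1"
    and w: "\<And>k. \<bar>g (1 / (x + real k + 1)) - g (1 / (y + real k + 1))\<bar> \<le> w k * \<bar>x - y\<bar>"
    and v: "\<And>k. \<bar>g (1 / (x + real (Suc k) + 1)) - g (1 / (x + real k + 1))\<bar> \<le> v k"
    and W: "\<And>n. (\<Sum>k<n. gauss_weight k y * w k) \<le> W"
    and V: "\<And>n. (\<Sum>k<n. v k * (real k + 1) / (real k + 2)\<^sup>2) \<le> V"
  shows "\<bar>gauss_transfer g x - gauss_transfer g y\<bar> \<le> (W + V) * \<bar>x - y\<bar>"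
proof -
  define a where "a k = g (1 / (x + real k + 1))" for k
  define b where "b k = g (1 / (y + real k + 1))" for k
  \<comment> \<open>The difference of the \<open>k\<close>-th partial sums of the weights at
    \<open>x\<close> and at \<open>y\<close>, in closed form.\<close>
  define D where "D k = real k / (x + real k + 1) - real k / (y + real k + 1)" for k
  \<comment> \<open>A bound for the boundary term of the summation by parts: \<open>D n\<close> is
    of order \<open>1 / n\<close> and \<open>a n\<close> at most of order \<open>sqrt n\<close>, so
    it vanishes in the limit.\<close>
  define R where "R n = B * sqrt (real n + 2) / (real n + 1)" for n
  have D_eq: "gauss_weight k x - gauss_weight k y = D (Suc k) - D k" for k
    using sum_gauss_weight[OF x(1), of "Suc k"] sum_gauss_weight[OF x(1), of k]
      sum_gauss_weight[OF y(1), of "Suc k"] sum_gauss_weight[OF y(1), of k]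
    by (simp add: D_def)
  have D_le: "\<bar>D k\<bar> \<le> \<bar>x - y\<bar> * (real k / (real k + 1)\<^sup>2)" for k
  proof -
    have "D k = real k * (y - x) / ((x + real k + 1) * (y + real k + 1))"
      using x y by (simp add: D_def divide_simps) (simp add: algebra_simps)
    then have "\<bar>D k\<bar> = real k * \<bar>x - y\<bar> / ((x + real k + 1) * (y + real k + 1))"
      using x y by (simp add: abs_mult abs_minus_commute)
    also have "\<dots> \<le> real k * \<bar>x - y\<bar> / ((real k + 1) * (real k + 1))"
      using x y by (intro divide_left_mono mult_mono mult_pos_pos) auto
    finally show ?thesis by (simp add: power2_eq_square mult.commute)
  qed
  have B: "0 \<le> B" using t[unfolded tame_def, rule_format, of 1] by simp
  have partial: "\<bar>(\<Sum>k<n. gauss_weight k x * a k) - (\<Sum>k<n. gauss_weight k y * b k)\<bar>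
      \<le> (W + V) * \<bar>x - y\<bar> + R n" for n
  proof -
    have "(\<Sum>k<n. gauss_weight k x * a k) - (\<Sum>k<n. gauss_weight k y * b k)
      = (\<Sum>k<n. gauss_weight k y * (a k - b k)) + (\<Sum>k<n. (gauss_weight k x - gauss_weight k y) * a k)"
      by (simp add: sum_subtractf[symmetric] sum.distrib[symmetric] algebra_simps)
    also have "(\<Sum>k<n. (gauss_weight k x - gauss_weight k y) * a k)
      = D n * a n - (\<Sum>k<n. D (Suc k) * (a (Suc k) - a k))"
      unfolding D_eq by (rule sum_by_parts) (simp add: D_def)
    finally have "\<bar>(\<Sum>k<n. gauss_weight k x * a k) - (\<Sum>k<n. gauss_weight k y * b k)\<bar>
      \<le> \<bar>\<Sum>k<n. gauss_weight k y * (a k - b k)\<bar> + \<bar>\<Sum>k<n. D (Suc k) * (a (Suc k) - a k)\<bar> + \<bar>D n * a n\<bar>"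
      by linarith
    moreover have "\<bar>\<Sum>k<n. gauss_weight k y * (a k - b k)\<bar> \<le> W * \<bar>x - y\<bar>"
    proof -
      have "\<bar>\<Sum>k<n. gauss_weight k y * (a k - b k)\<bar> \<le> (\<Sum>k<n. gauss_weight k y * (w k * \<bar>x - y\<bar>))"
        using w gauss_weight_nonneg[OF y(1)] by (intro sum_abs[THEN order_trans] sum_mono)
          (auto simp: abs_mult a_def b_def intro!: mult_left_mono)
      also have "\<dots> = (\<Sum>k<n. gauss_weight k y * w k) * \<bar>x - y\<bar>" by (simp add: sum_distrib_right mult.assoc)
      also have "\<dots> \<le> W * \<bar>x - y\<bar>" using W by (intro mult_right_mono) auto
      finally show ?thesis .
    qed
    moreover have "\<bar>\<Sum>k<n. D (Suc k) * (a (Suc k) - a k)\<bar> \<le> V * \<bar>x - y\<bar>"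
    proof -
      have "\<bar>D (Suc k) * (a (Suc k) - a k)\<bar> \<le> v k * (real k + 1) / (real k + 2)\<^sup>2 * \<bar>x - y\<bar>" for k
      proof -
        have "\<bar>D (Suc k) * (a (Suc k) - a k)\<bar> \<le> \<bar>x - y\<bar> * (real (Suc k) / (real (Suc k) + 1)\<^sup>2) * v k"
          unfolding abs_mult using v[of k] D_le[of "Suc k"] by (intro mult_mono) (auto simp: a_def)
        then show ?thesis by (simp add: ac_simps)
      qed
      then have "\<bar>\<Sum>k<n. D (Suc k) * (a (Suc k) - a k)\<bar> \<le> (\<Sum>k<n. v k * (real k + 1) / (real k + 2)\<^sup>2 * \<bar>x - y\<bar>)"
        by (intro sum_abs[THEN order_trans] sum_mono) 
      also have "\<dots> = (\<Sum>k<n. v k * (real k + 1) / (real k + 2)\<^sup>2) * \<bar>x - y\<bar>" by (simp add: sum_distrib_right)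
      also have "\<dots> \<le> V * \<bar>x - y\<bar>" using V by (intro mult_right_mono) auto
      finally show ?thesis .
    qed
    moreover have "\<bar>D n * a n\<bar> \<le> R n"
    proof -
      have "\<bar>a n\<bar> \<le> B * sqrt (x + real n + 1)" using t x by (auto simp: tame_def a_def)
      also have "\<dots> \<le> B * sqrt (real n + 2)" using B x by (intro mult_left_mono) auto
      finally have an: "\<bar>a n\<bar> \<le> B * sqrt (real n + 2)" .
      have "\<bar>D n\<bar> \<le> 1 * (real n / (real n + 1)\<^sup>2)"
        using x y by (intro D_le[THEN order_trans] mult_right_mono) auto
      also have "\<dots> \<le> (real n + 1) / (real n + 1)\<^sup>2" by (simp add: divide_right_mono)
      also have "\<dots> = 1 / (real n + 1)" by (simp add: power2_eq_square)
      finally have "\<bar>D n * a n\<bar> \<le> 1 / (real n + 1) * (B * sqrt (real n + 2))"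
        unfolding abs_mult using an by (intro mult_mono) auto
      then show ?thesis by (simp add: R_def)
    qed
    ultimately show ?thesis unfolding distrib_right by linarith
  qed
  have "(\<lambda>n. \<bar>(\<Sum>k<n. gauss_weight k x * a k) - (\<Sum>k<n. gauss_weight k y * b k)\<bar>)
      \<longlonglongrightarrow> \<bar>gauss_transfer g x - gauss_transfer g y\<bar>"
    unfolding gauss_transfer_def a_def b_def
    by (intro tendsto_rabs tendsto_diff summable_LIMSEQ summable_gauss_transfer[OF t] x y)
  moreover have "(\<lambda>n. (W + V) * \<bar>x - y\<bar> + R n) \<longlonglongrightarrow> (W + V) * \<bar>x - y\<bar> + 0"
  proof (intro tendsto_add tendsto_const)
    have "(\<lambda>n. sqrt (real n + 2) / (real n + 1)) \<longlonglongrightarrow> 0" by real_asymp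
    from tendsto_mult_left[OF this, of B] show "R \<longlonglongrightarrow> 0" by (simp add: R_def[abs_def])
  qed
  ultimately show ?thesis using partial by (intro LIMSEQ_le[of _ _ "\<lambda>n. (W + V) * \<bar>x - y\<bar> + R n"]) auto
qed

text \<open>All branches but the first gain a factor of at most 1/4, and the first has weight at
  most 1/2. The extreme case is 1/2 + 1/2 * 1/4.\<close>

lemma sum_gauss_weight_div_square_le:
  assumes "0 \<le> y" shows "(\<Sum>k<n. gauss_weight k y / (real k + 1)\<^sup>2) \<le> 5 / 8"
proof (cases n)
  case (Suc m)
  have g0: "gauss_weight 0 y \<le> 1 / 2" using assms by (simp add: gauss_weight_def divide_simps algebra_simps)
  have "(\<Sum>k<n. gauss_weight k y / (real k + 1)\<^sup>2)
      = gauss_weight 0 y + (\<Sum>k<m. gauss_weight (Suc k) y / (real (Suc k) + 1)\<^sup>2)"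
    unfolding Suc by (subst sum.lessThan_Suc_shift) simp
  also have "(\<Sum>k<m. gauss_weight (Suc k) y / (real (Suc k) + 1)\<^sup>2) \<le> (\<Sum>k<m. gauss_weight (Suc k) y / 2\<^sup>2)"
    using assms by (intro sum_mono divide_left_mono power_mono gauss_weight_nonneg) auto
  also have "\<dots> = ((\<Sum>k<n. gauss_weight k y) - gauss_weight 0 y) / 4"
    unfolding Suc by (subst sum.lessThan_Suc_shift) (simp add: sum_divide_distrib)
  also have "(\<Sum>k<n. gauss_weight k y) \<le> 1" using assms by (simp add: sum_gauss_weight)
  finally have "(\<Sum>k<n. gauss_weight k y / (real k + 1)\<^sup>2) \<le> gauss_weight 0 y + (1 - gauss_weight 0 y) / 4"
    by simp
  moreover have "s \<le> 5 / 8" if "s \<le> w + (1 - w) / 4" "w \<le> 1 / 2" for s w :: real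
    using that by (simp add: field_simps)
  ultimately show ?thesis using g0 by blast
qed simp

lemma sum_inverse_cube_le: "(\<Sum>k<n. 1 / (real k + 2) ^ 3) \<le> 1 / 4"
proof -
  \<comment> \<open>The subtracted term is the tail of the telescoping majorant
    \<open>1 / ((k + 1) * (k + 2) * (k + 3))\<close>; it makes the induction close.\<close>
  have "(\<Sum>k<n. 1 / (real k + 2) ^ 3) \<le> 1 / 4 - 1 / (2 * (real n + 1) * (real n + 2))"
  proof (induction n)
    case (Suc n)
    have "1 / (real n + 2) ^ 3 \<le> 1 / ((real n + 1) * (real n + 2) * (real n + 3))"
    proof (rule frac_le)
      show "0 < (real n + 1) * (real n + 2) * (real n + 3)" by (intro mult_pos_pos) auto
      show "(real n + 1) * (real n + 2) * (real n + 3) \<le> (real n + 2) ^ 3"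
        by (simp add: power3_eq_cube algebra_simps)
    qed auto
    also have "\<dots> = 1 / (2 * (real n + 1) * (real n + 2)) - 1 / (2 * (real n + 2) * (real n + 3))"
      by (simp add: divide_simps) (simp add: algebra_simps)
    finally show ?case using Suc by (simp add: ac_simps)
  qed simp
  also have "\<dots> \<le> 1 / 4" by simp
  finally show ?thesis .
qed

lemma sum_inverse_square_le: "(\<Sum>k<n. 1 / (real k + 2)\<^sup>2) \<le> 1"
proof -
  have "(\<Sum>k<n. 1 / (real k + 2)\<^sup>2) \<le> 1 - 1 / (real n + 1)"
  proof (induction n)
    case (Suc n)
    have "1 / (real n + 2) ^ 2 \<le> 1 / ((real n + 1) * (real n + 2))"
    proof (rule frac_le)
      show "0 < (real n + 1) * (real n + 2)" by (intro mult_pos_pos) auto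
      show "(real n + 1) * (real n + 2) \<le> (real n + 2)\<^sup>2"
        by (simp add: power2_eq_square algebra_simps)
    qed auto
    also have "\<dots> = 1 / (real n + 1) - 1 / (real n + 2)" by (simp add: divide_simps)
    finally show ?case using Suc by (simp add: ac_simps)
  qed simp
  also have "\<dots> \<le> 1" by simp
  finally show ?thesis .
qed

lemma lipschitz_unit_tame:
  assumes "M-lipschitz_on {0..1} g"
  shows "tame (\<bar>g 0\<bar> + M) g"
  unfolding tame_def
proof (intro allI impI)
  fix s :: real assume s: "1 \<le> s"
  have "dist (g (1 / s)) (g 0) \<le> M * dist (1 / s) 0" using s by (intro lipschitz_onD[OF assms]) auto
  also have "\<dots> \<le> M * 1" using s lipschitz_on_nonneg[OF assms] by (intro mult_left_mono) auto
  finally have "\<bar>g (1 / s)\<bar> \<le> (\<bar>g 0\<bar> + M) * 1" by (simp add: dist_real_def)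
  also have "\<dots> \<le> (\<bar>g 0\<bar> + M) * sqrt s" using s lipschitz_on_nonneg[OF assms] by (intro mult_left_mono) auto
  finally show "\<bar>g (1 / s)\<bar> \<le> (\<bar>g 0\<bar> + M) * sqrt s" .
qed

text \<open>The branches contract distances by at least \<open>1 / (k + 1)\<^sup>2\<close>, which
  contributes 5/8; the variation of the weights contributes 1/4. That the sum is below 1 drives all
  the convergence that follows.\<close>

lemma gauss_transfer_lipschitz:
  assumes g: "M-lipschitz_on {0..1} g"
  shows "(7 / 8 * M)-lipschitz_on {0..1} (gauss_transfer g)"
proof (rule lipschitz_onI)
  have M: "0 \<le> M" by (rule lipschitz_on_nonneg[OF g])
  then show "0 \<le> 7 / 8 * M" by simp
  fix x y :: real assume "x \<in> {0..1}" "y \<in> {0..1}"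
  then have x: "0 \<le> x" "x \<le> 1" and y: "0 \<le> y" "y \<le> 1" by auto
  have lip: "\<bar>g (1 / s) - g (1 / t)\<bar> \<le> M * (\<bar>s - t\<bar> / (s * t))" if "1 \<le> s" "1 \<le> t" for s t
  proof -
    have "dist (g (1 / s)) (g (1 / t)) \<le> M * dist (1 / s) (1 / t)"
      using that by (intro lipschitz_onD[OF g]) auto
    moreover have "1 / s - 1 / t = (t - s) / (s * t)" using that by (simp add: divide_simps)
    ultimately show ?thesis using that by (simp add: dist_real_def abs_minus_commute)
  qed
  have "\<bar>gauss_transfer g x - gauss_transfer g y\<bar> \<le> (5 / 8 * M + 1 / 4 * M) * \<bar>x - y\<bar>"
  proof (rule gauss_transfer_abs_diff_le[OF lipschitz_unit_tame[OF g] x y])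
    fix k
    have "\<bar>g (1 / (x + real k + 1)) - g (1 / (y + real k + 1))\<bar>
      \<le> M * (\<bar>(x + real k + 1) - (y + real k + 1)\<bar> / ((x + real k + 1) * (y + real k + 1)))"
      using x y by (intro lip) auto
    also have "\<dots> \<le> M * (\<bar>x - y\<bar> / ((real k + 1) * (real k + 1)))"
      using x y M by (intro mult_left_mono frac_le mult_mono mult_pos_pos) auto
    finally show "\<bar>g (1 / (x + real k + 1)) - g (1 / (y + real k + 1))\<bar> \<le> M / (real k + 1)\<^sup>2 * \<bar>x - y\<bar>"
      by (simp add: power2_eq_square)
    have "\<bar>g (1 / (x + real (Suc k) + 1)) - g (1 / (x + real k + 1))\<bar>
      \<le> M * (\<bar>(x + real (Suc k) + 1) - (x + real k + 1)\<bar> / ((x + real (Suc k) + 1) * (x + real k + 1)))"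
      using x y by (intro lip) auto
    also have "\<dots> \<le> M * (1 / ((real k + 2) * (real k + 1)))"
      using x y M by (intro mult_left_mono frac_le mult_mono mult_pos_pos) auto
    finally show "\<bar>g (1 / (x + real (Suc k) + 1)) - g (1 / (x + real k + 1))\<bar> \<le> M / ((real k + 1) * (real k + 2))"
      by (simp add: mult.commute)
  next
    fix n
    have "(\<Sum>k<n. gauss_weight k y * (M / (real k + 1)\<^sup>2)) = M * (\<Sum>k<n. gauss_weight k y / (real k + 1)\<^sup>2)"
      by (simp add: sum_distrib_left mult.commute)
    also have "\<dots> \<le> M * (5 / 8)" using M y sum_gauss_weight_div_square_le by (intro mult_left_mono) auto
    finally show "(\<Sum>k<n. gauss_weight k y * (M / (real k + 1)\<^sup>2)) \<le> 5 / 8 * M" by simp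
    have "M / ((real k + 1) * (real k + 2)) * (real k + 1) / (real k + 2)\<^sup>2 = M * (1 / (real k + 2) ^ 3)" for k
      by (simp add: power2_eq_square power3_eq_cube)
    then have "(\<Sum>k<n. M / ((real k + 1) * (real k + 2)) * (real k + 1) / (real k + 2)\<^sup>2) = M * (\<Sum>k<n. 1 / (real k + 2) ^ 3)"
      by (simp only: sum_distrib_left)
    also have "\<dots> \<le> M * (1 / 4)" using M sum_inverse_cube_le by (intro mult_left_mono) auto
    finally show "(\<Sum>k<n. M / ((real k + 1) * (real k + 2)) * (real k + 1) / (real k + 2)\<^sup>2) \<le> 1 / 4 * M" by simp
  qed
  then show "dist (gauss_transfer g x) (gauss_transfer g y) \<le> 7 / 8 * M * dist x y"
    by (simp add: dist_real_def distrib_right)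
qed

lemma ln_tame: "tame 2 (\<lambda>x. - ln x)"
  unfolding tame_def
proof (intro allI impI)
  fix s :: real assume s: "1 \<le> s"
  have "ln s = 2 * ln (sqrt s)" using s by (simp add: ln_sqrt)
  also have "\<dots> \<le> 2 * sqrt s" using ln_le_minus_one[of "sqrt s"] s by auto
  finally show "\<bar>- ln (1 / s)\<bar> \<le> 2 * sqrt s" using s by (simp add: ln_div)
qed

lemma abs_ln_diff_le:
  fixes r s t :: real
  assumes "0 < r" "r \<le> s" "r \<le> t" shows "\<bar>ln s - ln t\<bar> \<le> \<bar>s - t\<bar> / r"
proof -
  have *: "ln b - ln a \<le> (b - a) / r" if "r \<le> a" "a \<le> b" for a b
  proof -
    have "ln b - ln a \<le> (b - a) / a" using assms that by (intro ln_diff_le) auto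
    also have "\<dots> \<le> (b - a) / r" using assms that by (intro divide_left_mono) auto
    finally show ?thesis .
  qed
  show ?thesis
  proof (cases "s \<le> t")
    case True
    then have "ln s \<le> ln t" using assms by simp
    then show ?thesis using *[of s t] True assms by simp
  next
    case False
    then have "ln t \<le> ln s" using assms by simp
    then show ?thesis using *[of t s] False assms by simp
  qed
qed

text \<open>One application of the operator regularises: on branch \<open>k\<close> the function
  \<open>- ln\<close> becomes \<open>ln (y + real k + 1)\<close>, which is 1-Lipschitz. The values
  and the weights contribute 1 each.\<close>

lemma gauss_transfer_ln_lipschitz: "2-lipschitz_on {0..1} (gauss_transfer (\<lambda>x. - ln x))"
proof (rule lipschitz_onI)
  fix x y :: real assume "x \<in> {0..1}" "y \<in> {0..1}"
  then have x: "0 \<le> x" "x \<le> 1" and y: "0 \<le> y" "y \<le> 1" by auto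
  have "\<bar>gauss_transfer (\<lambda>x. - ln x) x - gauss_transfer (\<lambda>x. - ln x) y\<bar> \<le> (1 + 1) * \<bar>x - y\<bar>"
  proof (rule gauss_transfer_abs_diff_le[OF ln_tame x y])
    fix k
    have eq: "- ln (1 / (z + real k + 1)) = ln (z + real k + 1)" if "0 \<le> z" for z k
      using that by (simp add: ln_div)
    have "\<bar>ln (x + real k + 1) - ln (y + real k + 1)\<bar> \<le> \<bar>(x + real k + 1) - (y + real k + 1)\<bar> / 1"
      using x y by (intro abs_ln_diff_le) auto
    then show "\<bar>- ln (1 / (x + real k + 1)) - - ln (1 / (y + real k + 1))\<bar> \<le> 1 * \<bar>x - y\<bar>"
      unfolding eq[OF x(1)] eq[OF y(1)] by simp
    have "\<bar>ln (x + real (Suc k) + 1) - ln (x + real k + 1)\<bar> \<le> \<bar>(x + real (Suc k) + 1) - (x + real k + 1)\<bar> / (real k + 1)"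
      using x y by (intro abs_ln_diff_le) auto
    then show "\<bar>- ln (1 / (x + real (Suc k) + 1)) - - ln (1 / (x + real k + 1))\<bar> \<le> 1 / (real k + 1)"
      unfolding eq[OF x(1)] by simp
  next
    fix n
    show "(\<Sum>k<n. gauss_weight k y * 1) \<le> 1" using y by (simp add: sum_gauss_weight)
    show "(\<Sum>k<n. 1 / (real k + 1) * (real k + 1) / (real k + 2)\<^sup>2) \<le> 1"
      using sum_inverse_square_le[of n] by simp
  qed
  then show "dist (gauss_transfer (\<lambda>x. - ln x) x) (gauss_transfer (\<lambda>x. - ln x) y) \<le> 2 * dist x y"
    by (simp add: dist_real_def)
qed simp

section \<open>The Gauss measure\<close>

text \<open>Left unnormalised: the total mass is \<open>ln 2\<close>, and the usual factor
  \<open>1 / ln 2\<close> reappears in \<open>levy_constant\<close>.\<close>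

definition gauss_measure :: "real measure" where
  "gauss_measure = density lborel (\<lambda>x. ennreal (indicator {0..<1} x / (1 + x)))"

lemma gauss_map_measurable [measurable]: "gauss_map \<in> borel_measurable borel"
  unfolding gauss_map_def[abs_def] by measurable

lemma sets_gauss_measure [measurable_cong, simp]: "sets gauss_measure = sets borel"
  by (simp add: gauss_measure_def)

lemma space_gauss_measure [simp]: "space gauss_measure = UNIV"
  by (simp add: gauss_measure_def)

lemma AE_gauss_measure: "AE x in gauss_measure. 0 \<le> x \<and> x < 1"
  unfolding gauss_measure_def by (subst AE_density) (auto split: split_indicator)

lemma gauss_weight_measurable [measurable]: "gauss_weight k \<in> borel_measurable borel"
  unfolding gauss_weight_def[abs_def] by measurable

section \<open>Change of variables along the Gauss map\<close>

lemma nn_integral_gauss_measure: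
  assumes [measurable]: "f \<in> borel_measurable borel"
  shows "(\<integral>\<^sup>+x. f x \<partial>gauss_measure) = (\<integral>\<^sup>+x. ennreal (indicator {0..<1} x / (1 + x)) * f x \<partial>lborel)"
  unfolding gauss_measure_def by (rule nn_integral_density) auto

text \<open>The branch intervals are taken closed to fit the substitution rule. They then share
  endpoints, so uniqueness holds only off the countable set of these.\<close>

lemma gauss_branch_index:
  fixes x :: real assumes "0 < x" "x < 1" "\<And>k::nat. x \<noteq> 1 / (real k + 1)"
  shows "\<exists>k::nat. x \<in> {1 / (real k + 2)..1 / (real k + 1)} \<and>
    (\<forall>j::nat. x \<in> {1 / (real j + 2)..1 / (real j + 1)} \<longrightarrow> j = k)"
proof -
  define k where "k = nat \<lfloor>1 / x\<rfloor> - 1"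
  have iff: "x \<in> {1 / (real j + 2)..1 / (real j + 1)} \<longleftrightarrow> real j + 1 \<le> 1 / x \<and> 1 / x \<le> real j + 2" for j
    using assms(1) by (auto simp: field_simps)
  have ne: "1 / x \<noteq> real j + 1" for j using assms(3)[of j] by (metis div_by_1 divide_divide_eq_right mult_1)
  have "1 \<le> \<lfloor>1 / x\<rfloor>" using assms by simp
  moreover have "int (nat z - 1) + 1 = z" if "1 \<le> z" for z :: int using that by arith
  ultimately have "int k + 1 = \<lfloor>1 / x\<rfloor>" unfolding k_def by blast
  then have k: "real k + 1 = of_int \<lfloor>1 / x\<rfloor>" by (metis of_int_1 of_int_add of_int_of_nat_eq)
  show ?thesis
  proof (intro exI[of _ k] conjI allI impI)
    show "x \<in> {1 / (real k + 2)..1 / (real k + 1)}" unfolding iff using k by linarith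
    fix j assume "x \<in> {1 / (real j + 2)..1 / (real j + 1)}"
    then have "real j + 1 \<le> 1 / x" "1 / x \<le> real j + 2" unfolding iff by blast+
    moreover have "1 / x \<noteq> real j + 2" using ne[of "Suc j"] by simp
    ultimately have "\<lfloor>1 / x\<rfloor> = int j + 1" by (simp add: floor_eq_iff)
    then have "real k = real j" using k by simp
    then show "j = k" by simp
  qed
qed

text \<open>The inverse branch is decreasing, so the substitution uses the increasing map
  \<open>1 / (real k + 1 - s)\<close> on \<open>{-1..0}\<close>, followed by the reflection
  \<open>y = - s\<close>.\<close>

lemma nn_integral_gauss_branch:
  assumes [measurable]: "f \<in> borel_measurable borel"
  shows "(\<integral>\<^sup>+x. f x * indicator {1 / (real k + 2)..1 / (real k + 1)} x \<partial>lborel) =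
    (\<integral>\<^sup>+y. f (1 / (y + real k + 1)) * ennreal (1 / (y + real k + 1)\<^sup>2) * indicator {0..1} y \<partial>lborel)"
proof -
  have "(\<integral>\<^sup>+x. f x * indicator {1 / (real k + 1 - (-1))..1 / (real k + 1 - 0)} x \<partial>lborel) =
    (\<integral>\<^sup>+s. f (1 / (real k + 1 - s)) * ennreal (1 / (real k + 1 - s)\<^sup>2) * indicator {-1..0} s \<partial>lborel)"
  proof (rule nn_integral_substitution_aux)
    fix s :: real assume "s \<in> {-1..0}"
    then have "real k + 1 - s \<noteq> 0" by auto
    then show "((\<lambda>s. 1 / (real k + 1 - s)) has_real_derivative 1 / (real k + 1 - s)\<^sup>2) (at s)"
      by (auto intro!: derivative_eq_intros simp: power2_eq_square)
  next
    show "continuous_on {- 1..0} (\<lambda>s. 1 / (real k + 1 - s)\<^sup>2)"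
      by (intro continuous_intros) auto
  qed auto
  also have "\<dots> = (\<integral>\<^sup>+y. f (1 / (y + real k + 1)) * ennreal (1 / (y + real k + 1)\<^sup>2) * indicator {0..1} y \<partial>lborel)"
    by (subst nn_integral_real_affine[where c = "-1" and t = 0])
      (auto intro!: nn_integral_cong simp: ac_simps split: split_indicator)
  finally show ?thesis by (simp add: add.commute)
qed

lemma gauss_map_branch: "0 \<le> y \<Longrightarrow> y < 1 \<Longrightarrow> gauss_map (1 / (y + real k + 1)) = y"
proof -
  assume y: "0 \<le> y" "y < 1"
  have "\<lfloor>y + real k + 1\<rfloor> = int k + 1" using y by (simp add: floor_eq_iff)
  then show ?thesis using y by (simp add: gauss_map_def)
qed

text \<open>This identity explains \<open>gauss_weight\<close>: density at the preimage times
  Jacobian of the branch equals weight times density at \<open>y\<close>.\<close>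

lemma gauss_density_branch:
  assumes "0 < y" "y < 1"
  shows "indicator {0..<1} (1 / (y + real k + 1)) / (1 + 1 / (y + real k + 1)) * (1 / (y + real k + 1)\<^sup>2)
    = gauss_weight k y / (1 + y)"
proof -
  have "1 / (1 + 1 / z) * (1 / z\<^sup>2) = 1 / (z * (z + 1))" if "0 < z" for z :: real
    using that by (simp add: divide_simps power2_eq_square)
  from this[of "y + real k + 1"] show ?thesis using assms by (simp add: gauss_weight_def ac_simps)
qed

text \<open>Duality between composition with the Gauss map and the transfer operator, by a change of
  variables on each branch. For nonnegative extended values the sum and the integral may be
  exchanged freely. Constant \<open>F\<close> shows that the operator preserves integrals, constant
  \<open>\<phi>\<close> that the measure is invariant, and exponentials give the recursion for the
  moments.\<close>

lemma nn_integral_gauss_map: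
  fixes \<phi> F :: "real \<Rightarrow> ennreal"
  assumes [measurable]: "\<phi> \<in> borel_measurable borel" "F \<in> borel_measurable borel"
  shows "(\<integral>\<^sup>+x. \<phi> x * F (gauss_map x) \<partial>gauss_measure) =
    (\<integral>\<^sup>+y. (\<Sum>k. ennreal (gauss_weight k y) * \<phi> (1 / (y + real k + 1))) * F y \<partial>gauss_measure)"
proof -
  define w where "w x = ennreal (indicator {0..<1} x / (1 + x))" for x :: real
  have [measurable]: "w \<in> borel_measurable borel" unfolding w_def[abs_def] by measurable
  define B where "B k = {1 / (real k + 2)..1 / (real k + 1)}" for k :: nat
  have [measurable]: "B k \<in> sets borel" for k by (simp add: B_def)
  have "(\<integral>\<^sup>+x. \<phi> x * F (gauss_map x) \<partial>gauss_measure) = (\<integral>\<^sup>+x. w x * (\<phi> x * F (gauss_map x)) \<partial>lborel)"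
    unfolding w_def by (rule nn_integral_gauss_measure) measurable
  also have "\<dots> = (\<integral>\<^sup>+x. (\<Sum>k. w x * (\<phi> x * F (gauss_map x)) * indicator (B k) x) \<partial>lborel)"
  proof (rule nn_integral_cong_AE)
    \<comment> \<open>The point 0 lies in no branch interval and the endpoints may lie in two;
      together they form a null set.\<close>
    have "AE x in lborel. x \<notin> insert 0 (range (\<lambda>k::nat. 1 / (real k + 1)))"
      by (rule AE_not_in) (auto intro!: countable_imp_null_set_lborel)
    then show "AE x in lborel. w x * (\<phi> x * F (gauss_map x)) = (\<Sum>k. w x * (\<phi> x * F (gauss_map x)) * indicator (B k) x)"
    proof eventually_elim
      fix x :: real assume x: "x \<notin> insert 0 (range (\<lambda>k::nat. 1 / (real k + 1)))"
      show "w x * (\<phi> x * F (gauss_map x)) = (\<Sum>k. w x * (\<phi> x * F (gauss_map x)) * indicator (B k) x)"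
      proof (cases "0 < x \<and> x < 1")
        case True
        with x obtain k where k: "x \<in> B k" "\<And>j. x \<in> B j \<Longrightarrow> j = k"
          using gauss_branch_index[of x] unfolding B_def by blast
        have "(\<Sum>j. w x * (\<phi> x * F (gauss_map x)) * indicator (B j) x)
          = (\<Sum>j\<in>{k}. w x * (\<phi> x * F (gauss_map x)) * indicator (B j) x)"
          using k(2) by (intro suminf_finite) (auto split: split_indicator)
        then show ?thesis using k(1) by simp
      next
        case False
        then have "w x = 0" using x by (auto simp: w_def split: split_indicator)
        then show ?thesis by simp
      qed
    qed
  qed
  also have "\<dots> = (\<Sum>k. \<integral>\<^sup>+x. w x * (\<phi> x * F (gauss_map x)) * indicator (B k) x \<partial>lborel)"
    by (rule nn_integral_suminf) measurable
  also have "\<dots> = (\<Sum>k. \<integral>\<^sup>+y. w y * (ennreal (gauss_weight k y) * \<phi> (1 / (y + real k + 1)) * F y) \<partial>lborel)"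
  proof (rule suminf_cong)
    fix k
    have "AE y in lborel. y \<notin> {0, 1::real}"
      by (rule AE_not_in) (auto intro!: countable_imp_null_set_lborel)
    then have "AE y in lborel.
        w (1 / (y + real k + 1)) * (\<phi> (1 / (y + real k + 1)) * F (gauss_map (1 / (y + real k + 1)))) *
          ennreal (1 / (y + real k + 1)\<^sup>2) * indicator {0..1} y =
        w y * (ennreal (gauss_weight k y) * \<phi> (1 / (y + real k + 1)) * F y)"
    proof eventually_elim
      fix y :: real assume y: "y \<notin> {0, 1}"
      show "w (1 / (y + real k + 1)) * (\<phi> (1 / (y + real k + 1)) * F (gauss_map (1 / (y + real k + 1)))) *
          ennreal (1 / (y + real k + 1)\<^sup>2) * indicator {0..1} y =
        w y * (ennreal (gauss_weight k y) * \<phi> (1 / (y + real k + 1)) * F y)"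
      proof (cases "0 < y \<and> y < 1")
        case True
        have "w (1 / (y + real k + 1)) * ennreal (1 / (y + real k + 1)\<^sup>2) = ennreal (gauss_weight k y / (1 + y))"
          unfolding w_def using True gauss_density_branch[of y k] by (subst ennreal_mult[symmetric]) auto
        also have "\<dots> = w y * ennreal (gauss_weight k y)"
          using True gauss_weight_nonneg[of y k] by (simp add: w_def ennreal_mult[symmetric])
        finally have "w (1 / (y + real k + 1)) * ennreal (1 / (y + real k + 1)\<^sup>2) = w y * ennreal (gauss_weight k y)" .
        then have "w (1 / (y + real k + 1)) * ennreal (1 / (y + real k + 1)\<^sup>2) * (\<phi> (1 / (y + real k + 1)) * F y)
          = w y * ennreal (gauss_weight k y) * (\<phi> (1 / (y + real k + 1)) * F y)" by simp
        moreover have "gauss_map (1 / (y + real k + 1)) = y" using True by (simp add: gauss_map_branch)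
        ultimately show ?thesis using True by (simp add: mult.assoc mult.left_commute mult.commute)
      next
        case False
        then have "y < 0 \<or> 1 < y" using y by auto
        then show ?thesis by (auto simp: w_def split: split_indicator)
      qed
    qed
    then show "(\<integral>\<^sup>+x. w x * (\<phi> x * F (gauss_map x)) * indicator (B k) x \<partial>lborel) =
        (\<integral>\<^sup>+y. w y * (ennreal (gauss_weight k y) * \<phi> (1 / (y + real k + 1)) * F y) \<partial>lborel)"
      unfolding B_def by (subst nn_integral_gauss_branch) (auto intro!: nn_integral_cong_AE)
  qed
  also have "\<dots> = (\<integral>\<^sup>+y. (\<Sum>k. w y * (ennreal (gauss_weight k y) * \<phi> (1 / (y + real k + 1)) * F y)) \<partial>lborel)"
    by (rule nn_integral_suminf[symmetric]) measurable
  also have "\<dots> = (\<integral>\<^sup>+y. w y * ((\<Sum>k. ennreal (gauss_weight k y) * \<phi> (1 / (y + real k + 1))) * F y) \<partial>lborel)"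
    by (simp add: ennreal_suminf_cmult ennreal_suminf_multc)
  also have "\<dots> = (\<integral>\<^sup>+y. (\<Sum>k. ennreal (gauss_weight k y) * \<phi> (1 / (y + real k + 1))) * F y \<partial>gauss_measure)"
    unfolding w_def by (rule nn_integral_gauss_measure[symmetric]) measurable
  finally show ?thesis .
qed

text \<open>The duality with constant \<open>F\<close>. The indicator is there because the functions
  used are controlled on \<open>{0..1}\<close> only.\<close>

lemma nn_integral_gauss_transfer:
  assumes [measurable]: "(\<lambda>x. indicator {0..1} x * g x) \<in> borel_measurable borel"
    and t: "tame B g" and nn: "\<And>x. 0 < x \<Longrightarrow> x \<le> 1 \<Longrightarrow> 0 \<le> g x"
  shows "(\<integral>\<^sup>+x. ennreal (gauss_transfer g x) \<partial>gauss_measure) = (\<integral>\<^sup>+x. ennreal (g x) \<partial>gauss_measure)"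
proof -
  have "(\<integral>\<^sup>+x. ennreal (g x) \<partial>gauss_measure) = (\<integral>\<^sup>+x. ennreal (indicator {0..1} x * g x) * 1 \<partial>gauss_measure)"
    by (rule nn_integral_cong_AE, use AE_gauss_measure in eventually_elim) simp
  also have "\<dots> = (\<integral>\<^sup>+y. (\<Sum>k. ennreal (gauss_weight k y) *
      ennreal (indicator {0..1} (1 / (y + real k + 1)) * g (1 / (y + real k + 1)))) * 1 \<partial>gauss_measure)"
    by (rule nn_integral_gauss_map[where F = "\<lambda>_. 1"]) measurable
  also have "\<dots> = (\<integral>\<^sup>+x. ennreal (gauss_transfer g x) \<partial>gauss_measure)"
  proof (rule nn_integral_cong_AE, use AE_gauss_measure in eventually_elim)
    fix y :: real assume y: "0 \<le> y \<and> y < 1"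
    have "ennreal (gauss_weight k y) * ennreal (indicator {0..1} (1 / (y + real k + 1)) * g (1 / (y + real k + 1)))
      = ennreal (gauss_weight k y * g (1 / (y + real k + 1)))" for k
      using y by (subst ennreal_mult[symmetric]) (auto intro!: nn gauss_weight_nonneg)
    moreover have "(\<Sum>k. ennreal (gauss_weight k y * g (1 / (y + real k + 1)))) = ennreal (gauss_transfer g y)"
      unfolding gauss_transfer_def using y t
      by (intro suminf_ennreal2 summable_gauss_transfer mult_nonneg_nonneg nn gauss_weight_nonneg) auto
    ultimately show "(\<Sum>k. ennreal (gauss_weight k y) *
      ennreal (indicator {0..1} (1 / (y + real k + 1)) * g (1 / (y + real k + 1)))) * 1 = ennreal (gauss_transfer g y)"
      by simp
  qed
  finally show ?thesis ..
qed

lemma emeasure_gauss_measure_le: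
  assumes [measurable]: "A \<in> sets borel" shows "emeasure gauss_measure A \<le> emeasure lborel A"
proof -
  have "emeasure gauss_measure A = (\<integral>\<^sup>+x. ennreal (indicator {0..<1} x / (1 + x)) * indicator A x \<partial>lborel)"
    unfolding gauss_measure_def by (rule emeasure_density) auto
  also have "\<dots> \<le> (\<integral>\<^sup>+x. indicator A x \<partial>lborel)"
    by (intro nn_integral_mono) (auto split: split_indicator simp: divide_simps)
  finally show ?thesis by simp
qed

text \<open>The density \<open>1 / (1 + x)\<close> is at least 1/2 on the unit interval.\<close>

lemma emeasure_lborel_le_gauss_measure:
  assumes [measurable]: "A \<in> sets borel" and "A \<subseteq> {0..<1}"
  shows "emeasure lborel A \<le> 2 * emeasure gauss_measure A"
proof -
  have "emeasure lborel A = (\<integral>\<^sup>+x. indicator A x \<partial>lborel)" by simp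
  also have "\<dots> \<le> (\<integral>\<^sup>+x. 2 * (ennreal (indicator {0..<1} x / (1 + x)) * indicator A x) \<partial>lborel)"
  proof (intro nn_integral_mono)
    fix x :: real
    show "indicator A x \<le> 2 * (ennreal (indicator {0..<1} x / (1 + x)) * indicator A x)"
    proof (cases "x \<in> A")
      case True
      then have x: "0 \<le> x" "x < 1" using assms by auto
      have "ennreal 1 \<le> ennreal (2 * (1 / (1 + x)))" using x by (intro ennreal_leI) (simp add: divide_simps)
      also have "\<dots> = 2 * ennreal (1 / (1 + x))" using x by (subst ennreal_mult) auto
      finally show ?thesis using True x by simp
    qed simp
  qed
  also have "\<dots> = 2 * (\<integral>\<^sup>+x. ennreal (indicator {0..<1} x / (1 + x)) * indicator A x \<partial>lborel)"
    by (rule nn_integral_cmult) measurable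
  also have "\<dots> = 2 * emeasure gauss_measure A"
    unfolding gauss_measure_def by (subst emeasure_density) auto
  finally show ?thesis .
qed

text \<open>Invariance of the Gauss measure: the duality with \<open>\<phi>\<close> constant, where
  the weights sum to 1.\<close>

lemma emeasure_gauss_map_vimage:
  assumes [measurable]: "A \<in> sets borel"
  shows "emeasure gauss_measure ((gauss_map ^^ n) -` A) = emeasure gauss_measure A"
  using assms
proof (induction n arbitrary: A)
  case (Suc n)
  note [measurable] = Suc.prems
  have [measurable]: "(gauss_map ^^ n) \<in> borel_measurable borel" by measurable
  define C where "C = (gauss_map ^^ n) -` A"
  have C[measurable]: "C \<in> sets borel" using measurable_sets_borel[of "gauss_map ^^ n" borel A] Suc.prems by (simp add: C_def)
  have V: "gauss_map -` C \<in> sets borel" using measurable_sets_borel[of gauss_map borel C] by simp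
  have "emeasure gauss_measure (gauss_map -` C) = (\<integral>\<^sup>+x. indicator (gauss_map -` C) x \<partial>gauss_measure)"
    using V by simp
  also have "\<dots> = (\<integral>\<^sup>+x. 1 * indicator C (gauss_map x) \<partial>gauss_measure)"
    by (intro nn_integral_cong) (simp split: split_indicator)
  also have "\<dots> = (\<integral>\<^sup>+y. (\<Sum>k. ennreal (gauss_weight k y) * 1) * indicator C y \<partial>gauss_measure)"
    by (rule nn_integral_gauss_map[where \<phi> = "\<lambda>_. 1"]) measurable
  also have "\<dots> = (\<integral>\<^sup>+y. indicator C y \<partial>gauss_measure)"
  proof (rule nn_integral_cong_AE, use AE_gauss_measure in eventually_elim)
    fix y :: real assume y: "0 \<le> y \<and> y < 1"
    have "(\<Sum>k. ennreal (gauss_weight k y)) = ennreal 1"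
      using y by (intro suminf_ennreal_eq gauss_weight_nonneg gauss_weight_sums) auto
    then show "(\<Sum>k. ennreal (gauss_weight k y) * 1) * indicator C y = indicator C y" by simp
  qed
  also have "\<dots> = emeasure gauss_measure A" using Suc.IH[OF Suc.prems] by (simp add: C_def[symmetric])
  finally have "emeasure gauss_measure (gauss_map -` C) = emeasure gauss_measure A" .
  moreover have "(gauss_map ^^ Suc n) -` A = gauss_map -` C"
    by (simp add: C_def funpow_Suc_right del: funpow.simps) auto
  ultimately show ?case by (simp only:)
qed simp

section \<open>Total mass and the integral of \<open>- ln\<close>\<close>

lemma emeasure_gauss_measure_UNIV: "emeasure gauss_measure UNIV = ennreal (ln 2)"
proof -
  have "emeasure gauss_measure UNIV = (\<integral>\<^sup>+x. ennreal (indicator {0..<1} x / (1 + x)) \<partial>lborel)"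
    unfolding gauss_measure_def by (subst emeasure_density) auto
  also have "\<dots> = (\<integral>\<^sup>+x. ennreal (1 / (1 + x)) * indicator {0..1} x \<partial>lborel)"
  proof (rule nn_integral_cong_AE)
    have "AE y in lborel. y \<notin> {1::real}"
      by (rule AE_not_in) (auto intro!: countable_imp_null_set_lborel)
    then show "AE x in lborel. ennreal (indicator {0..<1} x / (1 + x)) = ennreal (1 / (1 + x)) * indicator {0..1} x"
      by eventually_elim (auto split: split_indicator)
  qed
  also have "\<dots> = ennreal (ln (1 + 1) - ln (1 + 0))"
  proof (rule nn_integral_FTC_Icc)
    fix x :: real assume "x \<in> {0..1}"
    then show "((\<lambda>x. ln (1 + x)) has_real_derivative 1 / (1 + x)) (at x)"
      by (auto intro!: derivative_eq_intros)
qed auto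
  finally show ?thesis by simp
qed

text \<open>The primitive \<open>F\<close> is written in terms of \<open>x * ln x\<close>, so that
  its limit 0 at the left end is visible for \<open>m = 0\<close> as well.\<close>

lemma nn_integral_power_ln:
  "(\<integral>\<^sup>+x. ennreal (indicator {0<..<1} x * (x ^ m * - ln x)) \<partial>lborel) = ennreal (1 / (real m + 1)\<^sup>2)"
proof -
  define F where "F x = x ^ m * (x * (1 / (real m + 1)\<^sup>2) - x * ln x / (real m + 1))" for x :: real
  define f where "f x = x ^ m * - ln x" for x :: real
  have D: "(F has_real_derivative f x) (at x)" if "0 < x" for x
  proof -
    have "F = (\<lambda>x. x ^ Suc m * (1 / (real m + 1)\<^sup>2 - ln x / (real m + 1)))"
      by (rule ext) (simp add: F_def algebra_simps)
    moreover have "((\<lambda>x. x ^ Suc m * (1 / (real m + 1)\<^sup>2 - ln x / (real m + 1))) has_real_derivative f x) (at x)"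
    proof -
      have P: "((\<lambda>x. x ^ Suc m) has_real_derivative (real m + 1) * x ^ m) (at x)"
        using DERIV_pow[of "Suc m" x] by (simp del: power_Suc add: add.commute)
      have Q: "((\<lambda>x. 1 / (real m + 1)\<^sup>2 - ln x / (real m + 1)) has_real_derivative - (1 / x / (real m + 1))) (at x)"
        using that by (auto intro!: derivative_eq_intros)
      have "(real m + 1) * x ^ m * (1 / (real m + 1)\<^sup>2 - ln x / (real m + 1)) + - (1 / x / (real m + 1)) * x ^ Suc m = f x"
        using that by (simp add: f_def power2_eq_square divide_simps) (simp add: algebra_simps)
      then show ?thesis using DERIV_mult[OF P Q] by simp
    qed
    ultimately show ?thesis by simp
  qed
  have C: "isCont f x" if "0 < x" for x
    unfolding f_def[abs_def] using that by (intro continuous_intros) auto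
  have nn: "0 \<le> f x" if "0 < x" "x < 1" for x
    using that by (simp add: f_def mult_nonneg_nonpos)
  have lim0: "(F \<longlongrightarrow> 0) (at_right 0)"
  proof -
    have "((\<lambda>x::real. x * ln x) \<longlongrightarrow> 0) (at_right 0)" by real_asymp
    then have "((\<lambda>x. x ^ m * (x * (1 / (real m + 1)\<^sup>2) - x * ln x / (real m + 1))) \<longlongrightarrow>
        0 ^ m * (0 * (1 / (real m + 1)\<^sup>2) - 0 / (real m + 1))) (at_right 0)"
      by (intro tendsto_intros) auto
    then show ?thesis by (simp add: F_def[abs_def])
  qed
  have "isCont F 1" by (rule DERIV_isCont[OF D]) simp
  then have lim1: "(F \<longlongrightarrow> 1 / (real m + 1)\<^sup>2) (at_left 1)"
    unfolding isCont_def filterlim_at_split by (simp add: F_def)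
  \<comment> \<open>Integrability and value come from two versions of the fundamental theorem for
    improper integrals of nonnegative functions, so the limit conditions occur twice.\<close>
  have int: "set_integrable lborel (einterval 0 1) f" "(LBINT x=0..1. f x) = 1 / (real m + 1)\<^sup>2 - 0"
  proof (rule_tac [!] interval_integral_FTC_nonneg)
    show "((F \<circ> real_of_ereal) \<longlongrightarrow> 0) (at_right 0)"
      using lim0 by (simp add: zero_ereal_def ereal_tendsto_simps)
    show "((F \<circ> real_of_ereal) \<longlongrightarrow> 1 / (real m + 1)\<^sup>2) (at_left 1)"
      using lim1 by (simp add: one_ereal_def ereal_tendsto_simps)
    then show "((F \<circ> real_of_ereal) \<longlongrightarrow> 1 / (real m + 1)\<^sup>2) (at_left 1)" .
    show "((F \<circ> real_of_ereal) \<longlongrightarrow> 0) (at_right 0)"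
      using lim0 by (simp add: zero_ereal_def ereal_tendsto_simps)
  qed (auto simp: D C nn)
  have E: "einterval 0 1 = {0<..<1::real}" by (auto simp: einterval_def)
  have "(\<integral>\<^sup>+x. ennreal (indicator {0<..<1} x * f x) \<partial>lborel) = ennreal (LBINT x:{0<..<1}. f x)"
    using int(1) unfolding set_integrable_def set_lebesgue_integral_def E
    by (subst nn_integral_eq_integral[symmetric])
      (auto simp: f_def mult_nonneg_nonpos split: split_indicator)
  also have "(LBINT x:{0<..<1}. f x) = (LBINT x=0..1. f x)"
    by (simp add: interval_lebesgue_integral_def E)
  finally show ?thesis using int(2) by (simp add: f_def)
qed

text \<open>From the sum of all inverse squares, twice the sum over even numbers is removed; the
  latter sum is a quarter of the whole.\<close>

lemma alternating_inverse_squares_sums: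
  "(\<lambda>n. 1 / (2 * real n + 1)\<^sup>2 - 1 / (2 * real n + 2)\<^sup>2) sums (pi\<^sup>2 / 12)"
proof -
  have 1: "(\<lambda>n. 1 / (real n + 1)\<^sup>2) sums (pi\<^sup>2 / 6)" using inverse_squares_sums by (simp add: add.commute)
  have "{n * 2..<n * 2 + 2} = {n * 2, Suc (n * 2)}" for n :: nat by auto
  then have 2: "(\<lambda>n. 1 / (2 * real n + 1)\<^sup>2 + 1 / (2 * real n + 2)\<^sup>2) sums (pi\<^sup>2 / 6)"
    using sums_group[OF 1, of 2] by (simp add: ac_simps)
  have "1 / (2 * (real n + 1))\<^sup>2 = 1 / 4 * (1 / (real n + 1)\<^sup>2)" for n by (simp only: power_mult_distrib) simp
  then have "(\<lambda>n. 1 / (2 * real n + 2)\<^sup>2) sums (1 / 4 * (pi\<^sup>2 / 6))"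
    using sums_mult[OF 1, of "1 / 4"] by (simp add: distrib_left)
  from sums_diff[OF 2 sums_mult[OF this, of 2]] show ?thesis by simp
qed

text \<open>The factor \<open>1 / (1 + x)\<close> is expanded into the alternating geometric series.
  Grouping the terms in pairs makes them nonnegative, so the series may be integrated term by
  term.\<close>

lemma nn_integral_neg_ln: "(\<integral>\<^sup>+x. ennreal (- ln x) \<partial>gauss_measure) = ennreal (pi\<^sup>2 / 12)"
proof -
  define h where "h n x = indicator {0<..<1} x * (x ^ n * - ln x)" for n and x :: real
  have h_nn: "0 \<le> h n x" for n x
    by (auto simp: h_def mult_nonneg_nonpos split: split_indicator)
  have h_Suc: "h (Suc n) x \<le> h n x" for n x
    by (auto simp: h_def mult_le_cancel_right mult_right_le_one_le split: split_indicator)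
  have [measurable]: "h n \<in> borel_measurable borel" for n unfolding h_def[abs_def] by measurable
  have int: "(\<integral>\<^sup>+x. ennreal (h n x) \<partial>lborel) = ennreal (1 / (real n + 1)\<^sup>2)" for n
    unfolding h_def by (rule nn_integral_power_ln)
  have "(\<integral>\<^sup>+x. ennreal (- ln x) \<partial>gauss_measure) = (\<integral>\<^sup>+x. ennreal (indicator {0..<1} x / (1 + x)) * ennreal (- ln x) \<partial>lborel)"
    by (rule nn_integral_gauss_measure) measurable
  also have "\<dots> = (\<integral>\<^sup>+x. (\<Sum>n. ennreal (h (2 * n) x - h (2 * n + 1) x)) \<partial>lborel)"
  proof (rule nn_integral_cong)
    fix x :: real
    show "ennreal (indicator {0..<1} x / (1 + x)) * ennreal (- ln x) = (\<Sum>n. ennreal (h (2 * n) x - h (2 * n + 1) x))"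
    proof (cases "0 < x \<and> x < 1")
      case True
      then have "x\<^sup>2 < 1" by (simp add: power_less_one_iff abs_square_less_1)
      then have S: "(\<lambda>n. (x\<^sup>2) ^ n) sums (1 / (1 - x\<^sup>2))" by (intro geometric_sums) simp
      have "h (2 * n) x - h (2 * n + 1) x = (1 - x) * - ln x * (x\<^sup>2) ^ n" for n
      proof -
        have "x ^ (2 * n) = (x\<^sup>2) ^ n" "x ^ (2 * n + 1) = x * (x\<^sup>2) ^ n" by (simp_all add: power_mult)
        then have "h (2 * n) x - h (2 * n + 1) x = (x\<^sup>2) ^ n * - ln x - x * (x\<^sup>2) ^ n * - ln x"
          using True by (simp only: h_def) simp
        then show ?thesis by (simp add: algebra_simps)
      qed
      then have "(\<lambda>n. h (2 * n) x - h (2 * n + 1) x) sums ((1 - x) * - ln x * (1 / (1 - x\<^sup>2)))"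
        by (simp only: sums_mult[OF S])
      moreover have "(1 - x) * - ln x * (1 / (1 - x\<^sup>2)) = 1 / (1 + x) * - ln x"
      proof -
        have "1 - x\<^sup>2 = (1 - x) * (1 + x)" by (simp add: power2_eq_square algebra_simps)
        then show ?thesis using True by simp
      qed
      ultimately have "(\<Sum>n. ennreal (h (2 * n) x - h (2 * n + 1) x)) = ennreal (1 / (1 + x) * - ln x)"
        using h_Suc by (intro suminf_ennreal_eq) auto
      also have "\<dots> = ennreal (1 / (1 + x)) * ennreal (- ln x)" using True by (subst ennreal_mult) auto
      finally show ?thesis using True by simp
    next
      case False
      then have "indicator {0..<1} x * - ln x = 0" by (auto split: split_indicator)
      moreover have "h n x = 0" for n using False by (auto simp: h_def)
      ultimately show ?thesis by (auto split: split_indicator)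
    qed
  qed
  also have "\<dots> = (\<Sum>n. \<integral>\<^sup>+x. ennreal (h (2 * n) x - h (2 * n + 1) x) \<partial>lborel)"
    by (rule nn_integral_suminf) measurable
  also have "\<dots> = (\<Sum>n. ennreal (1 / (2 * real n + 1)\<^sup>2 - 1 / (2 * real n + 2)\<^sup>2))"
  proof (rule suminf_cong)
    fix n
    have "(\<integral>\<^sup>+x. ennreal (h (2 * n) x - h (2 * n + 1) x) \<partial>lborel)
      = (\<integral>\<^sup>+x. ennreal (h (2 * n) x) - ennreal (h (2 * n + 1) x) \<partial>lborel)"
      by (simp add: ennreal_minus h_nn)
    also have "\<dots> = (\<integral>\<^sup>+x. ennreal (h (2 * n) x) \<partial>lborel) - (\<integral>\<^sup>+x. ennreal (h (2 * n + 1) x) \<partial>lborel)"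
    proof (rule nn_integral_diff)
      show "(\<integral>\<^sup>+x. ennreal (h (2 * n + 1) x) \<partial>lborel) \<noteq> \<infinity>" unfolding int by simp
      show "AE x in lborel. ennreal (h (2 * n + 1) x) \<le> ennreal (h (2 * n) x)"
        using h_Suc by (auto intro!: AE_I2 ennreal_leI)
    qed measurable
    also have "\<dots> = ennreal (1 / (2 * real n + 1)\<^sup>2 - 1 / (2 * real n + 2)\<^sup>2)"
      unfolding int by (subst ennreal_minus) (simp_all add: add.commute)
    finally show "(\<integral>\<^sup>+x. ennreal (h (2 * n) x - h (2 * n + 1) x) \<partial>lborel)
      = ennreal (1 / (2 * real n + 1)\<^sup>2 - 1 / (2 * real n + 2)\<^sup>2)" .
  qed
  also have "\<dots> = ennreal (pi\<^sup>2 / 12)"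
    by (rule suminf_ennreal_eq[OF _ alternating_inverse_squares_sums]) (auto intro!: divide_left_mono power_mono)
  finally show ?thesis .
qed

section \<open>Large deviations of the Birkhoff sums\<close>

lemma exp_le_quadratic: "exp z \<le> 1 + z + z\<^sup>2 * exp \<bar>z\<bar> / 2" for z :: real
proof -
  obtain t where t: "\<bar>t\<bar> \<le> \<bar>z\<bar>" "exp z = (\<Sum>m<2. z ^ m / fact m) + exp t / fact 2 * z ^ 2"
    using Maclaurin_exp_le[of z 2] by blast
  have "exp t * z\<^sup>2 \<le> exp \<bar>z\<bar> * z\<^sup>2" using t(1) by (intro mult_right_mono) auto
  then show ?thesis using t(2) by (simp add: numeral_2_eq_2 mult.commute)
qed

text \<open>Second-order Taylor estimate. One factor \<open>exp (\<bar>d\<bar> / 4)\<close> pays for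
  the exponential in the remainder, another for \<open>d\<^sup>2\<close>; their product is at most
  \<open>exp (B / 2) * sqrt s\<close>, a growth that the weights can still sum.\<close>

lemma exp_mult_le:
  fixes t d L B :: real
  assumes "\<bar>t\<bar> \<le> 1 / 4" "\<bar>d\<bar> \<le> ln s + B" "1 \<le> s"
  shows "exp (t * d) \<le> 1 + t * d + t\<^sup>2 * (16 * exp (B / 2)) * sqrt s"
proof -
  have 1: "exp \<bar>t * d\<bar> \<le> exp (\<bar>d\<bar> / 4)"
    using assms(1) mult_right_mono[OF assms(1), of "\<bar>d\<bar>"] by (simp add: abs_mult)
  have "1 + \<bar>d\<bar> / 4 + (\<bar>d\<bar> / 4)\<^sup>2 / 2 \<le> exp (\<bar>d\<bar> / 4)" by (rule exp_lower_Taylor_quadratic) simp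
  then have 2: "d\<^sup>2 \<le> 32 * exp (\<bar>d\<bar> / 4)" by (simp add: power_divide)
  have "(t * d)\<^sup>2 * exp \<bar>t * d\<bar> / 2 = t\<^sup>2 * (d\<^sup>2 * exp \<bar>t * d\<bar> / 2)" by (simp add: power_mult_distrib)
  also have "\<dots> \<le> t\<^sup>2 * (32 * exp (\<bar>d\<bar> / 4) * exp (\<bar>d\<bar> / 4) / 2)"
    using 1 2 by (intro mult_left_mono divide_right_mono mult_mono) auto
  also have "\<dots> = t\<^sup>2 * 16 * exp (\<bar>d\<bar> / 2)" by (simp add: exp_add[symmetric])
  also have "\<dots> \<le> t\<^sup>2 * 16 * exp (ln s / 2 + B / 2)" using assms(2) by (intro mult_left_mono) auto
  also have "exp (ln s / 2 + B / 2) = exp (B / 2) * sqrt s"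
    using assms(3) by (simp add: exp_add ln_sqrt[symmetric] mult.commute)
  finally show ?thesis using exp_le_quadratic[of "t * d"] by (simp add: ac_simps)
qed

text \<open>The mean of \<open>- ln\<close> under the normalised Gauss measure; known from Levy's
  theorem as the growth rate of the logarithms of the denominators of convergents.\<close>

definition levy_constant :: real where "levy_constant = pi\<^sup>2 / (12 * ln 2)"

lemma levy_constant_pos: "0 < levy_constant"
  by (simp add: levy_constant_def)

section \<open>Convergence of the iterates of the transfer operator on \<open>- ln\<close>\<close>

lemma lipschitz_unit_indicator_measurable:
  fixes g :: "real \<Rightarrow> real"
  assumes "M-lipschitz_on {0..1} g"
  shows "(\<lambda>x. indicator {0..1} x * g x) \<in> borel_measurable borel"
  using assms borel_measurable_continuous_on_indicator[of "{0..1}" g] lipschitz_on_continuous_on[of M "{0..1}" g]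
  by simp

text \<open>The numbering starts after one application, since only from there on are the iterates
  Lipschitz.\<close>

definition ln_transfer :: "nat \<Rightarrow> real \<Rightarrow> real" where
  "ln_transfer n = (gauss_transfer ^^ Suc n) (\<lambda>x. - ln x)"

lemma ln_transfer_0: "ln_transfer 0 = gauss_transfer (\<lambda>x. - ln x)"
  by (simp add: ln_transfer_def)

lemma ln_transfer_Suc: "ln_transfer (Suc n) = gauss_transfer (ln_transfer n)"
  by (simp add: ln_transfer_def)

lemma ln_transfer_lipschitz: "(2 * (7 / 8) ^ n)-lipschitz_on {0..1} (ln_transfer n)"
proof (induction n)
  case 0 show ?case using gauss_transfer_ln_lipschitz by (simp add: ln_transfer_0)
next
  case (Suc n)
  from gauss_transfer_lipschitz[OF this] show ?case by (simp add: ln_transfer_Suc)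
qed

lemma gauss_transfer_nonneg:
  assumes "tame B g" "\<And>x. 0 < x \<Longrightarrow> x \<le> 1 \<Longrightarrow> 0 \<le> g x" "0 \<le> x" "x \<le> 1"
  shows "0 \<le> gauss_transfer g x"
  unfolding gauss_transfer_def using assms
  by (intro suminf_nonneg summable_gauss_transfer mult_nonneg_nonneg gauss_weight_nonneg) auto

lemma ln_transfer_nonneg: "0 \<le> x \<Longrightarrow> x \<le> 1 \<Longrightarrow> 0 \<le> ln_transfer n x"
proof (induction n arbitrary: x)
  case 0 then show ?case unfolding ln_transfer_0 by (intro gauss_transfer_nonneg[OF ln_tame]) auto
next
  case (Suc n)
  show ?case unfolding ln_transfer_Suc
    by (rule gauss_transfer_nonneg[OF lipschitz_unit_tame[OF ln_transfer_lipschitz]]) (use Suc in auto)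
qed

lemma nn_integral_ln_transfer: "(\<integral>\<^sup>+x. ennreal (ln_transfer n x) \<partial>gauss_measure) = ennreal (pi\<^sup>2 / 12)"
proof (induction n)
  case 0
  show ?case unfolding ln_transfer_0 nn_integral_neg_ln[symmetric]
    by (rule nn_integral_gauss_transfer[OF _ ln_tame]) auto
next
  case (Suc n)
  show ?case unfolding ln_transfer_Suc Suc[symmetric]
    by (rule nn_integral_gauss_transfer[OF _ lipschitz_unit_tame[OF ln_transfer_lipschitz]])
      (auto intro: lipschitz_unit_indicator_measurable[OF ln_transfer_lipschitz] ln_transfer_nonneg)
qed

text \<open>The operator preserves the mean, which is Levy's constant, and on the unit interval a
  function differs from its mean by at most its Lipschitz constant.\<close>

lemma abs_ln_transfer_minus_levy:
  assumes x: "0 \<le> x" "x \<le> 1"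
  shows "\<bar>ln_transfer n x - levy_constant\<bar> \<le> 2 * (7 / 8) ^ n"
proof -
  define c where "c = 2 * (7 / 8 :: real) ^ n"
  have c: "0 \<le> c" by (simp add: c_def)
  have osc: "\<bar>ln_transfer n y - ln_transfer n x\<bar> \<le> c" if "0 \<le> y" "y < 1" for y
  proof -
    have "dist (ln_transfer n y) (ln_transfer n x) \<le> c * dist y x"
      unfolding c_def using x that by (intro lipschitz_onD[OF ln_transfer_lipschitz]) auto
    also have "\<dots> \<le> c * 1" using x that c by (intro mult_left_mono) (auto simp: dist_real_def)
    finally show ?thesis by (simp add: dist_real_def)
  qed
  have const: "(\<integral>\<^sup>+x. ennreal r \<partial>gauss_measure) = ennreal (r * ln 2)" if "0 \<le> r" for r
    using that by (simp add: emeasure_gauss_measure_UNIV ennreal_mult)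
  have lev: "levy_constant * ln 2 = pi\<^sup>2 / 12" by (simp add: levy_constant_def)
  have nn: "0 \<le> ln_transfer n x" using x by (rule ln_transfer_nonneg)
  have "ennreal (pi\<^sup>2 / 12) \<le> (\<integral>\<^sup>+y. ennreal (ln_transfer n x + c) \<partial>gauss_measure)"
    unfolding nn_integral_ln_transfer[of n, symmetric]
  proof (rule nn_integral_mono_AE, use AE_gauss_measure in eventually_elim)
    fix y :: real assume "0 \<le> y \<and> y < 1"
    then show "ennreal (ln_transfer n y) \<le> ennreal (ln_transfer n x + c)"
      using osc[of y] by (intro ennreal_leI) auto
  qed
  then have "ennreal (levy_constant * ln 2) \<le> ennreal ((ln_transfer n x + c) * ln 2)"
    unfolding lev using const[of "ln_transfer n x + c"] nn c by (simp only: add_nonneg_nonneg)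
  then have "levy_constant * ln 2 \<le> (ln_transfer n x + c) * ln 2"
    using nn c by (subst (asm) ennreal_le_iff) auto
  then have up: "levy_constant \<le> ln_transfer n x + c" by (simp add: mult_le_cancel_right)
  \<comment> \<open>Conversion to \<open>ennreal\<close> truncates negative numbers, so a negative
    lower bound is treated apart.\<close>
  have low: "ln_transfer n x - c \<le> levy_constant"
  proof (cases "ln_transfer n x - c \<le> 0")
    case True then show ?thesis using levy_constant_pos by linarith
  next
    case False
    have "(\<integral>\<^sup>+y. ennreal (ln_transfer n x - c) \<partial>gauss_measure) \<le> ennreal (pi\<^sup>2 / 12)"
      unfolding nn_integral_ln_transfer[of n, symmetric]
    proof (rule nn_integral_mono_AE, use AE_gauss_measure in eventually_elim)
      fix y :: real assume "0 \<le> y \<and> y < 1"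
      then show "ennreal (ln_transfer n x - c) \<le> ennreal (ln_transfer n y)"
        using osc[of y] by (intro ennreal_leI) auto
    qed
    then have "ennreal ((ln_transfer n x - c) * ln 2) \<le> ennreal (levy_constant * ln 2)"
      unfolding lev using const[of "ln_transfer n x - c"] False by (simp only: linear[of _ "0 :: real"] not_le less_imp_le)
    then have "(ln_transfer n x - c) * ln 2 \<le> levy_constant * ln 2"
      using levy_constant_pos by (subst (asm) ennreal_le_iff) auto
    then show ?thesis by (simp add: mult_le_cancel_right)
  qed
  show ?thesis using up low by (simp add: c_def abs_le_iff)
qed

(* With L the transfer operator and c Levy's constant, u is the sum of the iterates of
   L(- ln) - c, truncated where the remainder falls below the error allowed. *)
lemma approximate_poisson_solution:
  assumes "0 < \<delta>"
  obtains u :: "real \<Rightarrow> real" and U where "u \<in> borel_measurable borel" "0 \<le> U" "\<And>x. \<bar>u x\<bar> \<le> U"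
    "\<And>y. 0 \<le> y \<Longrightarrow> y < 1 \<Longrightarrow> \<exists>r. \<bar>r\<bar> \<le> \<delta> \<and>
      (\<lambda>k. gauss_weight k y * (ln (y + real k + 1) - levy_constant + u (1 / (y + real k + 1)) - u y)) sums r"
proof -
  have "(\<lambda>n. 2 * (7 / 8 :: real) ^ n) \<longlonglongrightarrow> 2 * 0" by (intro tendsto_mult tendsto_const LIMSEQ_realpow_zero) auto
  then have "eventually (\<lambda>n. 2 * (7 / 8 :: real) ^ n < \<delta>) sequentially" using assms by (simp add: order_tendsto_iff)
  then obtain N where N: "2 * (7 / 8 :: real) ^ N < \<delta>" by (auto simp: eventually_sequentially)
  \<comment> \<open>The indicators make \<open>u\<close> Borel measurable and bounded on the whole
    line.\<close>
  define u where "u x = (\<Sum>n<N. indicator {0..1} x * ln_transfer n x - indicator {0..1} x * levy_constant)" for x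
  define U where "U = (\<Sum>n<N. 2 * (7 / 8 :: real) ^ n)"
  have u_eq: "u x = (\<Sum>n<N. ln_transfer n x - levy_constant)" if "0 \<le> x" "x \<le> 1" for x
    using that by (simp add: u_def)
  have meas: "u \<in> borel_measurable borel"
    unfolding u_def[abs_def]
    by (intro borel_measurable_sum borel_measurable_diff lipschitz_unit_indicator_measurable[OF ln_transfer_lipschitz]) auto
  have bound: "\<bar>u x\<bar> \<le> U" for x
  proof (cases "0 \<le> x \<and> x \<le> 1")
    case True
    then show ?thesis unfolding U_def by (subst u_eq)
      (auto intro!: order_trans[OF sum_abs] sum_mono abs_ln_transfer_minus_levy)
  next
    case False then show ?thesis by (auto simp: u_def U_def intro!: sum_nonneg)
  qed
  have "\<exists>r. \<bar>r\<bar> \<le> \<delta> \<and>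
      (\<lambda>k. gauss_weight k y * (ln (y + real k + 1) - levy_constant + u (1 / (y + real k + 1)) - u y)) sums r"
    if y: "0 \<le> y" "y < 1" for y
  proof (intro exI conjI)
    have S: "(\<lambda>k. gauss_weight k y * g (1 / (y + real k + 1))) sums gauss_transfer g y" if "tame B g" for B g
      unfolding gauss_transfer_def using that y by (intro summable_sums summable_gauss_transfer) auto
    have W: "(\<lambda>k. gauss_weight k y * c) sums c" for c
      using sums_mult2[OF gauss_weight_sums[OF y(1)], of c] by simp
    have 1: "(\<lambda>k. gauss_weight k y * ln (y + real k + 1)) sums ln_transfer 0 y"
      using S[OF ln_tame] y by (simp add: ln_transfer_0 ln_div)
    have 2: "(\<lambda>k. gauss_weight k y * ln_transfer n (1 / (y + real k + 1))) sums ln_transfer (Suc n) y" for n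
      unfolding ln_transfer_Suc by (rule S[OF lipschitz_unit_tame[OF ln_transfer_lipschitz]])
    have "(\<lambda>k. \<Sum>n<N. gauss_weight k y * ln_transfer n (1 / (y + real k + 1)) - gauss_weight k y * levy_constant)
        sums (\<Sum>n<N. ln_transfer (Suc n) y - levy_constant)"
      by (intro sums_sum sums_diff 2 W)
    then have 3: "(\<lambda>k. gauss_weight k y * u (1 / (y + real k + 1))) sums (\<Sum>n<N. ln_transfer (Suc n) y - levy_constant)"
      using y by (simp add: u_eq sum_distrib_left right_diff_distrib)
    have "(\<lambda>k. gauss_weight k y * ln (y + real k + 1) - gauss_weight k y * levy_constant
        + gauss_weight k y * u (1 / (y + real k + 1)) - gauss_weight k y * u y)
      sums (ln_transfer 0 y - levy_constant + (\<Sum>n<N. ln_transfer (Suc n) y - levy_constant) - u y)"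
      by (intro sums_diff sums_add 1 3 W)
    \<comment> \<open>The difference of the transferred \<open>u\<close> and \<open>u\<close>
      telescopes; only \<open>ln_transfer N y - levy_constant\<close> survives in the total, and
      \<open>N\<close> was chosen to make it small.\<close>
    moreover have "(\<Sum>n<N. ln_transfer (Suc n) y - levy_constant) - u y = ln_transfer N y - ln_transfer 0 y"
    proof -
      have "(\<Sum>n<N. ln_transfer (Suc n) y - levy_constant) - u y = (\<Sum>n<N. ln_transfer (Suc n) y - ln_transfer n y)"
        using y by (simp add: u_eq sum_subtractf[symmetric])
      then show ?thesis using sum_lessThan_telescope[of "\<lambda>n. ln_transfer n y" N] by simp
    qed
    ultimately show "(\<lambda>k. gauss_weight k y * (ln (y + real k + 1) - levy_constant + u (1 / (y + real k + 1)) - u y))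
      sums (ln_transfer N y - levy_constant)"
      by (simp add: algebra_simps)
    show "\<bar>ln_transfer N y - levy_constant\<bar> \<le> \<delta>" using abs_ln_transfer_minus_levy[of y N] y N by linarith
  qed
  moreover have "0 \<le> U" by (auto simp: U_def intro: sum_nonneg)
  ultimately show thesis using that[of u U] meas bound by blast
qed

section \<open>Exponential moments of the Birkhoff sums\<close>

definition birkhoff_ln :: "nat \<Rightarrow> real \<Rightarrow> real" where
  "birkhoff_ln m x = (\<Sum>i<m. - ln ((gauss_map ^^ i) x))"

lemma birkhoff_ln_Suc: "birkhoff_ln (Suc m) x = - ln x + birkhoff_ln m (gauss_map x)"
  unfolding birkhoff_ln_def by (subst sum.lessThan_Suc_shift) (simp add: funpow_swap1)

lemma birkhoff_ln_measurable [measurable]: "birkhoff_ln m \<in> borel_measurable borel"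
  unfolding birkhoff_ln_def[abs_def] by measurable

text \<open>Weighting the integrand with \<open>exp (t * u x)\<close> makes the recursion close:
  each step then costs only a factor \<open>exp (\<bar>t\<bar> * \<delta>)\<close>. As
  \<open>u\<close> is bounded, the weight can be removed at the end for a constant factor.\<close>

lemma exp_moment_bound:
  assumes "0 < \<delta>"
  obtains \<theta> C :: real where "0 < \<theta>" "0 < C"
    "\<And>t m. \<bar>t\<bar> \<le> \<theta> \<Longrightarrow> (\<integral>\<^sup>+x. ennreal (exp (t * (birkhoff_ln m x - levy_constant * real m))) \<partial>gauss_measure)
       \<le> ennreal (C * exp (\<bar>t\<bar> * \<delta> * real m))"
proof -
  obtain u U where u[measurable]: "u \<in> borel_measurable borel" and U: "0 \<le> U" "\<And>x. \<bar>u x\<bar> \<le> U"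
    and pois: "\<And>y. 0 \<le> y \<Longrightarrow> y < 1 \<Longrightarrow> \<exists>r. \<bar>r\<bar> \<le> \<delta> / 2 \<and>
      (\<lambda>k. gauss_weight k y * (ln (y + real k + 1) - levy_constant + u (1 / (y + real k + 1)) - u y)) sums r"
    using approximate_poisson_solution[of "\<delta> / 2"] assms by auto
  define B where "B = levy_constant + 2 * U"
  define D where "D = 16 * exp (B / 2)"
  define S where "S = (\<Sum>k. 2 / (real k + 1) powr (3 / 2))"
  have S: "0 \<le> S" unfolding S_def by (intro suminf_nonneg summable_powr_three_halves) auto
  \<comment> \<open>The first bound is the one of \<open>exp_mult_le\<close>; the second keeps the
    quadratic term \<open>t\<^sup>2 * D * S\<close> below
    \<open>\<bar>t\<bar> * (\<delta> / 2)\<close>, and its summand 1 keeps the divisor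
    positive.\<close>
  define \<theta> where "\<theta> = min (1 / 4) (\<delta> / (2 * (D * S + 1)))"
  have D: "0 < D" by (simp add: D_def)
  have DS: "0 < D * S + 1" using D S by (simp add: add_nonneg_pos)
  have \<theta>: "0 < \<theta>" using assms DS by (simp add: \<theta>_def)
  define d where "d k y = ln (y + real k + 1) - levy_constant + u (1 / (y + real k + 1)) - u y" for k y
  \<comment> \<open>One step of the recursion: the linear term costs at most half of
    \<open>\<delta>\<close> by the choice of \<open>u\<close>, the quadratic term the other
    half.\<close>
  have local: "(\<Sum>k. ennreal (gauss_weight k y * exp (t * d k y))) \<le> ennreal (exp (\<bar>t\<bar> * \<delta>))"
    if t: "\<bar>t\<bar> \<le> \<theta>" and y: "0 \<le> y" "y < 1" for t y
  proof -
    obtain r where r: "\<bar>r\<bar> \<le> \<delta> / 2" "(\<lambda>k. gauss_weight k y * d k y) sums r"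
      using pois[OF y] unfolding d_def by blast
    have t4: "\<bar>t\<bar> \<le> 1 / 4" and tD: "\<bar>t\<bar> \<le> \<delta> / (2 * (D * S + 1))" using t by (simp_all add: \<theta>_def)
    define a where "a k = gauss_weight k y + t * (gauss_weight k y * d k y) + t\<^sup>2 * D * (2 / (real k + 1) powr (3 / 2))" for k
    have a: "a sums (1 + t * r + t\<^sup>2 * D * S)"
      unfolding a_def[abs_def] S_def using y
      by (intro sums_add sums_mult r(2) gauss_weight_sums summable_sums summable_powr_three_halves) auto
    have le: "gauss_weight k y * exp (t * d k y) \<le> a k" for k
    proof -
      have "0 \<le> ln (y + real k + 1)" using y by simp
      then have "\<bar>d k y\<bar> \<le> ln (y + real k + 1) + B"
        using U(2)[of "1 / (y + real k + 1)"] U(2)[of y] levy_constant_pos by (simp add: d_def B_def)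
      then have "exp (t * d k y) \<le> 1 + t * d k y + t\<^sup>2 * D * sqrt (y + real k + 1)"
        unfolding D_def using t4 y by (intro exp_mult_le) auto
      then have "gauss_weight k y * exp (t * d k y) \<le> gauss_weight k y * (1 + t * d k y + t\<^sup>2 * D * sqrt (y + real k + 1))"
        using gauss_weight_nonneg[OF y(1)] by (rule mult_left_mono)
      also have "\<dots> = gauss_weight k y + t * (gauss_weight k y * d k y) + t\<^sup>2 * D * (gauss_weight k y * sqrt (y + real k + 1))"
        by (simp add: algebra_simps)
      also have "\<dots> \<le> a k"
        unfolding a_def using gauss_weight_sqrt_le[of y k] y D by (intro add_left_mono mult_left_mono) auto
      finally show ?thesis .
    qed
    have a_nn: "0 \<le> a k" for k
      using le[of k] gauss_weight_nonneg[OF y(1), of k] by (meson exp_ge_zero mult_nonneg_nonneg order_trans)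
    have "(\<Sum>k. ennreal (gauss_weight k y * exp (t * d k y))) \<le> (\<Sum>k. ennreal (a k))"
      using le by (intro suminf_le ennreal_leI) auto
    also have "\<dots> = ennreal (1 + t * r + t\<^sup>2 * D * S)" by (rule suminf_ennreal_eq[OF a_nn a])
    also have "\<dots> \<le> ennreal (exp (\<bar>t\<bar> * \<delta>))"
    proof (rule ennreal_leI)
      have "t * r \<le> \<bar>t\<bar> * \<bar>r\<bar>" by (simp add: abs_mult[symmetric])
      also have "\<dots> \<le> \<bar>t\<bar> * (\<delta> / 2)" using r(1) by (intro mult_left_mono) auto
      finally have 1: "t * r \<le> \<bar>t\<bar> * (\<delta> / 2)" .
      have "t\<^sup>2 * D * S \<le> \<bar>t\<bar> * (\<bar>t\<bar> * (D * S + 1))"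
        by (simp add: power2_eq_square algebra_simps abs_mult_self_eq)
      also have "\<dots> \<le> \<bar>t\<bar> * (\<delta> / (2 * (D * S + 1)) * (D * S + 1))"
        using tD DS by (intro mult_left_mono mult_right_mono) auto
      also have "\<delta> / (2 * (D * S + 1)) * (D * S + 1) = \<delta> / 2"
        using DS by (metis mult.commute mult_divide_mult_cancel_left less_irrefl times_divide_eq_right)
      finally have 2: "t\<^sup>2 * D * S \<le> \<bar>t\<bar> * (\<delta> / 2)" .
      have "1 + t * r + t\<^sup>2 * D * S \<le> 1 + \<bar>t\<bar> * \<delta>" using 1 2 by (simp add: field_simps)
      also have "\<dots> \<le> exp (\<bar>t\<bar> * \<delta>)" by (rule exp_ge_add_one_self)
      finally show "1 + t * r + t\<^sup>2 * D * S \<le> exp (\<bar>t\<bar> * \<delta>)" .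
    qed
    finally show ?thesis .
  qed
  define Q where "Q t m x = exp (t * (birkhoff_ln m x - levy_constant * real m))" for t m x
  have [measurable]: "Q t m \<in> borel_measurable borel" for t m unfolding Q_def[abs_def] by measurable
  have main: "(\<integral>\<^sup>+x. ennreal (exp (t * u x)) * ennreal (Q t m x) \<partial>gauss_measure)
      \<le> ennreal (exp (\<bar>t\<bar> * \<delta>) ^ m * exp (\<bar>t\<bar> * U))" if t: "\<bar>t\<bar> \<le> \<theta>" for t m
  proof (induction m)
    case 0
    have "(\<integral>\<^sup>+x. ennreal (exp (t * u x)) * ennreal (Q t 0 x) \<partial>gauss_measure) \<le> (\<integral>\<^sup>+x. ennreal (exp (\<bar>t\<bar> * U)) \<partial>gauss_measure)"
    proof (intro nn_integral_mono)
      fix x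
      have "t * u x \<le> \<bar>t\<bar> * \<bar>u x\<bar>" by (simp add: abs_mult[symmetric])
      also have "\<dots> \<le> \<bar>t\<bar> * U" using U by (intro mult_left_mono) auto
      finally show "ennreal (exp (t * u x)) * ennreal (Q t 0 x) \<le> ennreal (exp (\<bar>t\<bar> * U))"
        by (simp add: Q_def birkhoff_ln_def)
    qed
    also have "\<dots> = ennreal (exp (\<bar>t\<bar> * U)) * ennreal (ln 2)" by (simp add: emeasure_gauss_measure_UNIV)
    also have "\<dots> \<le> ennreal (exp (\<bar>t\<bar> * U)) * ennreal 1" 
      using ln_2_less_1 by (intro mult_left_mono ennreal_leI) auto
    finally show ?case by simp
  next
    case (Suc m)
    have "(\<integral>\<^sup>+x. ennreal (exp (t * u x)) * ennreal (Q t (Suc m) x) \<partial>gauss_measure)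
      = (\<integral>\<^sup>+x. ennreal (exp (t * (- ln x - levy_constant + u x))) * ennreal (Q t m (gauss_map x)) \<partial>gauss_measure)"
      by (intro nn_integral_cong)
        (simp add: Q_def birkhoff_ln_Suc ennreal_mult[symmetric] exp_add[symmetric] algebra_simps)
    also have "\<dots> = (\<integral>\<^sup>+y. (\<Sum>k. ennreal (gauss_weight k y) *
        ennreal (exp (t * (- ln (1 / (y + real k + 1)) - levy_constant + u (1 / (y + real k + 1)))))) * ennreal (Q t m y) \<partial>gauss_measure)"
      by (rule nn_integral_gauss_map) measurable
    also have "\<dots> \<le> (\<integral>\<^sup>+y. ennreal (exp (\<bar>t\<bar> * \<delta>)) * (ennreal (exp (t * u y)) * ennreal (Q t m y)) \<partial>gauss_measure)"
    proof (rule nn_integral_mono_AE, use AE_gauss_measure in eventually_elim)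
      fix y :: real assume y: "0 \<le> y \<and> y < 1"
      have "ennreal (gauss_weight k y) * ennreal (exp (t * (- ln (1 / (y + real k + 1)) - levy_constant + u (1 / (y + real k + 1)))))
        = ennreal (gauss_weight k y * exp (t * d k y)) * ennreal (exp (t * u y))" for k
        using y gauss_weight_nonneg[of y k]
        by (simp add: ennreal_mult[symmetric] mult.assoc exp_add[symmetric] d_def ln_div algebra_simps)
      then have "(\<Sum>k. ennreal (gauss_weight k y) *
        ennreal (exp (t * (- ln (1 / (y + real k + 1)) - levy_constant + u (1 / (y + real k + 1))))))
        = (\<Sum>k. ennreal (gauss_weight k y * exp (t * d k y))) * ennreal (exp (t * u y))"
        by (simp add: ennreal_suminf_multc)
      also have "\<dots> \<le> ennreal (exp (\<bar>t\<bar> * \<delta>)) * ennreal (exp (t * u y))"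
        using local[OF t, of y] y by (intro mult_right_mono) auto
      finally show "(\<Sum>k. ennreal (gauss_weight k y) *
        ennreal (exp (t * (- ln (1 / (y + real k + 1)) - levy_constant + u (1 / (y + real k + 1)))))) * ennreal (Q t m y)
        \<le> ennreal (exp (\<bar>t\<bar> * \<delta>)) * (ennreal (exp (t * u y)) * ennreal (Q t m y))"
        by (simp add: mult.assoc[symmetric] mult_right_mono)
    qed
    also have "\<dots> = ennreal (exp (\<bar>t\<bar> * \<delta>)) * (\<integral>\<^sup>+y. ennreal (exp (t * u y)) * ennreal (Q t m y) \<partial>gauss_measure)"
      by (rule nn_integral_cmult) measurable
    also have "\<dots> \<le> ennreal (exp (\<bar>t\<bar> * \<delta>)) * ennreal (exp (\<bar>t\<bar> * \<delta>) ^ m * exp (\<bar>t\<bar> * U))"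
      using Suc by (intro mult_left_mono) auto
    also have "\<dots> = ennreal (exp (\<bar>t\<bar> * \<delta>) ^ Suc m * exp (\<bar>t\<bar> * U))"
      by (simp add: ennreal_mult[symmetric] mult.assoc)
    finally show ?case .
  qed
  \<comment> \<open>The weight is at least \<open>exp (- U)\<close>, since
    \<open>\<bar>t\<bar> \<le> 1 / 4\<close>.\<close>
  have "(\<integral>\<^sup>+x. ennreal (Q t m x) \<partial>gauss_measure) \<le> ennreal (exp (2 * U) * exp (\<bar>t\<bar> * \<delta> * real m))"
    if t: "\<bar>t\<bar> \<le> \<theta>" for t m
  proof -
    have t1: "\<bar>t\<bar> * U \<le> U" using t U by (intro mult_left_le_one_le) (auto simp: \<theta>_def)
    have "(\<integral>\<^sup>+x. ennreal (Q t m x) \<partial>gauss_measure)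
      \<le> (\<integral>\<^sup>+x. ennreal (exp U) * (ennreal (exp (t * u x)) * ennreal (Q t m x)) \<partial>gauss_measure)"
    proof (intro nn_integral_mono)
      fix x
      have "- (t * u x) \<le> \<bar>t\<bar> * \<bar>u x\<bar>" by (simp add: abs_mult[symmetric])
      also have "\<dots> \<le> \<bar>t\<bar> * U" using U by (intro mult_left_mono) auto
      finally have "1 \<le> exp (U + t * u x)" using t1 by simp
      then have "1 * Q t m x \<le> exp (U + t * u x) * Q t m x" by (rule mult_right_mono) (simp add: Q_def)
      then show "ennreal (Q t m x) \<le> ennreal (exp U) * (ennreal (exp (t * u x)) * ennreal (Q t m x))"
        by (simp add: ennreal_mult[symmetric] exp_add mult.assoc Q_def)
    qed
    also have "\<dots> = ennreal (exp U) * (\<integral>\<^sup>+x. ennreal (exp (t * u x)) * ennreal (Q t m x) \<partial>gauss_measure)"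
      by (rule nn_integral_cmult) measurable
    also have "\<dots> \<le> ennreal (exp U) * ennreal (exp (\<bar>t\<bar> * \<delta>) ^ m * exp (\<bar>t\<bar> * U))"
      using main[OF t] by (intro mult_left_mono) auto
    also have "\<dots> = ennreal (exp (U + \<bar>t\<bar> * U) * exp (\<bar>t\<bar> * \<delta> * real m))"
      by (simp add: ennreal_mult[symmetric] exp_add exp_of_nat_mult[symmetric] ac_simps)
    also have "\<dots> \<le> ennreal (exp (2 * U) * exp (\<bar>t\<bar> * \<delta> * real m))"
      using t1 by (intro ennreal_leI mult_right_mono) auto
    finally show ?thesis .
  qed
  then show thesis using that[of \<theta> "exp (2 * U)"] \<theta> by (simp add: Q_def)
qed

text \<open>Chernoff's bound, with \<open>t = \<theta>\<close> for the upper and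
  \<open>t = - \<theta>\<close> for the lower tail. Moments are used with
  \<open>\<delta> / 2\<close>, which leaves the rate \<open>\<theta> * \<delta> / 2\<close>.\<close>

lemma birkhoff_ln_large_deviations:
  assumes "0 < \<delta>"
  obtains A \<alpha> :: real where "0 < A" "0 < \<alpha>"
    "\<And>m. emeasure gauss_measure {x. \<delta> * real m \<le> \<bar>birkhoff_ln m x - levy_constant * real m\<bar>}
       \<le> ennreal (A * exp (- \<alpha> * real m))"
proof -
  obtain \<theta> C where \<theta>: "0 < \<theta>" "0 < C"
    and bnd: "\<And>t m. \<bar>t\<bar> \<le> \<theta> \<Longrightarrow> (\<integral>\<^sup>+x. ennreal (exp (t * (birkhoff_ln m x - levy_constant * real m))) \<partial>gauss_measure)
       \<le> ennreal (C * exp (\<bar>t\<bar> * (\<delta> / 2) * real m))"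
    using exp_moment_bound[of "\<delta> / 2"] assms by auto
  define P where "P t m = {x. exp (\<theta> * \<delta> * real m) \<le> exp (t * (birkhoff_ln m x - levy_constant * real m))}" for t m
  have P_sets[measurable]: "P t m \<in> sets borel" for t m unfolding P_def by measurable
  have chernoff: "emeasure gauss_measure (P t m) \<le> ennreal (C * exp (- (\<theta> * \<delta> / 2) * real m))"
    if t: "\<bar>t\<bar> = \<theta>" for t m
  proof -
    have "emeasure gauss_measure (P t m) = (\<integral>\<^sup>+x. indicator (P t m) x \<partial>gauss_measure)" by simp
    also have "\<dots> \<le> (\<integral>\<^sup>+x. ennreal (exp (- (\<theta> * \<delta> * real m))) *
        ennreal (exp (t * (birkhoff_ln m x - levy_constant * real m))) \<partial>gauss_measure)"
    proof (intro nn_integral_mono)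
      fix x
      show "indicator (P t m) x \<le> ennreal (exp (- (\<theta> * \<delta> * real m))) *
        ennreal (exp (t * (birkhoff_ln m x - levy_constant * real m)))"
      proof (cases "x \<in> P t m")
        case True
        then have "1 \<le> exp (- (\<theta> * \<delta> * real m)) * exp (t * (birkhoff_ln m x - levy_constant * real m))"
          by (simp add: P_def exp_add[symmetric])
        then show ?thesis using True by (simp add: ennreal_mult[symmetric])
      qed simp
    qed
    also have "\<dots> = ennreal (exp (- (\<theta> * \<delta> * real m))) *
        (\<integral>\<^sup>+x. ennreal (exp (t * (birkhoff_ln m x - levy_constant * real m))) \<partial>gauss_measure)"
      by (rule nn_integral_cmult) measurable
    also have "\<dots> \<le> ennreal (exp (- (\<theta> * \<delta> * real m))) * ennreal (C * exp (\<theta> * (\<delta> / 2) * real m))"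
      using bnd[of t m] t by (intro mult_left_mono) auto
    also have "\<dots> = ennreal (C * (exp (- (\<theta> * \<delta> * real m)) * exp (\<theta> * (\<delta> / 2) * real m)))"
      using \<theta> by (simp add: ennreal_mult[symmetric] ac_simps)
    also have "exp (- (\<theta> * \<delta> * real m)) * exp (\<theta> * (\<delta> / 2) * real m) = exp (- (\<theta> * \<delta> / 2) * real m)"
      by (simp add: exp_add[symmetric] field_simps)
    finally show ?thesis .
  qed
  have "emeasure gauss_measure {x. \<delta> * real m \<le> \<bar>birkhoff_ln m x - levy_constant * real m\<bar>}
       \<le> ennreal (2 * C * exp (- (\<theta> * \<delta> / 2) * real m))" for m
  proof -
    have "{x. \<delta> * real m \<le> \<bar>birkhoff_ln m x - levy_constant * real m\<bar>} \<subseteq> P \<theta> m \<union> P (- \<theta>) m"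
    proof
      fix x assume "x \<in> {x. \<delta> * real m \<le> \<bar>birkhoff_ln m x - levy_constant * real m\<bar>}"
      then have "\<theta> * (\<delta> * real m) \<le> \<theta> * \<bar>birkhoff_ln m x - levy_constant * real m\<bar>"
        using \<theta> by (intro mult_left_mono) auto
      moreover have "\<theta> * \<bar>z\<bar> = \<theta> * z \<or> \<theta> * \<bar>z\<bar> = - \<theta> * z" for z by (cases "0 \<le> z") auto
      ultimately show "x \<in> P \<theta> m \<union> P (- \<theta>) m"
        unfolding P_def Un_iff mem_Collect_eq exp_le_cancel_iff mult.assoc by metis
    qed
    then have "emeasure gauss_measure {x. \<delta> * real m \<le> \<bar>birkhoff_ln m x - levy_constant * real m\<bar>}
      \<le> emeasure gauss_measure (P \<theta> m \<union> P (- \<theta>) m)" by (rule emeasure_mono) simp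
    also have "\<dots> \<le> emeasure gauss_measure (P \<theta> m) + emeasure gauss_measure (P (- \<theta>) m)"
      by (rule emeasure_subadditive) auto
    also have "\<dots> \<le> ennreal (C * exp (- (\<theta> * \<delta> / 2) * real m)) + ennreal (C * exp (- (\<theta> * \<delta> / 2) * real m))"
      using \<theta> by (intro add_mono chernoff) auto
    also have "\<dots> = ennreal (2 * C * exp (- (\<theta> * \<delta> / 2) * real m))"
      using \<theta> by (subst ennreal_plus[symmetric]) auto
    finally show ?thesis .
  qed
  then show thesis using that[of "2 * C" "\<theta> * \<delta> / 2"] \<theta> assms by simp
qed

section \<open>\<open>\<beta>\<close>-expansions\<close>

lemma beta_map_frac: "beta_map \<beta> x = frac (\<beta> * x)"
  by (simp add: beta_map_def frac_def)

lemma beta_map_range: "beta_map \<beta> x \<in> {0..<1}"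
  by (simp add: beta_map_frac frac_lt_1)

lemma beta_iter_range: "x \<in> {0..<1} \<Longrightarrow> (beta_map \<beta> ^^ n) x \<in> {0..<1}"
  using beta_map_range by (cases n) auto

lemma beta_map_measurable [measurable]: "beta_map \<beta> \<in> borel_measurable borel"
  unfolding beta_map_def[abs_def] by measurable

lemma beta_map_le: "0 \<le> \<beta> \<Longrightarrow> 0 \<le> x \<Longrightarrow> beta_map \<beta> x \<le> \<beta> * x"
  by (simp add: beta_map_def)

lemma beta_iter_le:
  assumes "0 \<le> \<beta>" "x \<in> {0..<1}" shows "(beta_map \<beta> ^^ (j + k)) x \<le> \<beta> ^ k * (beta_map \<beta> ^^ j) x"
proof (induction k)
  case (Suc k)
  have "(beta_map \<beta> ^^ (j + Suc k)) x \<le> \<beta> * (beta_map \<beta> ^^ (j + k)) x"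
    using beta_map_le[OF assms(1)] beta_iter_range[OF assms(2), of "j + k" \<beta>] by simp
  also have "\<dots> \<le> \<beta> * (\<beta> ^ k * (beta_map \<beta> ^^ j) x)" using Suc assms by (intro mult_left_mono) auto
  finally show ?case by (simp add: mult.assoc)
qed simp

lemma mem_beta_cylinder_iff:
  "y \<in> beta_cylinder \<beta> n (\<lambda>i. beta_digit \<beta> i x) \<longleftrightarrow> y \<in> {0..<1} \<and>
    (\<forall>i<n. \<lfloor>\<beta> * (beta_map \<beta> ^^ i) y\<rfloor> = \<lfloor>\<beta> * (beta_map \<beta> ^^ i) x\<rfloor>)"
proof -
  have "(\<forall>j\<in>{1..n}. P (j - 1)) \<longleftrightarrow> (\<forall>i<n. P i)" for P :: "nat \<Rightarrow> bool"
  proof (intro iffI allI impI)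
    fix i assume "\<forall>j\<in>{1..n}. P (j - 1)" "i < n"
    then show "P i" by (metis Suc_leI atLeastAtMost_iff diff_Suc_1 le_add1 plus_1_eq_Suc)
  qed auto
  from this[of "\<lambda>i. \<lfloor>\<beta> * (beta_map \<beta> ^^ i) y\<rfloor> = \<lfloor>\<beta> * (beta_map \<beta> ^^ i) x\<rfloor>"]
  show ?thesis by (simp add: beta_cylinder_def beta_digit_def)
qed

text \<open>While the digits agree, the two orbits undergo the same affine maps of slope
  \<open>\<beta>\<close>.\<close>

lemma beta_cylinder_diff:
  assumes "y \<in> beta_cylinder \<beta> n (\<lambda>i. beta_digit \<beta> i x)"
  shows "(beta_map \<beta> ^^ n) x - (beta_map \<beta> ^^ n) y = \<beta> ^ n * (x - y)"
proof -
  have "k \<le> n \<Longrightarrow> (beta_map \<beta> ^^ k) x - (beta_map \<beta> ^^ k) y = \<beta> ^ k * (x - y)" for k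
  proof (induction k)
    case (Suc k)
    then have "\<lfloor>\<beta> * (beta_map \<beta> ^^ k) y\<rfloor> = \<lfloor>\<beta> * (beta_map \<beta> ^^ k) x\<rfloor>"
      using assms by (auto simp: mem_beta_cylinder_iff)
    then have "(beta_map \<beta> ^^ Suc k) x - (beta_map \<beta> ^^ Suc k) y
        = \<beta> * ((beta_map \<beta> ^^ k) x - (beta_map \<beta> ^^ k) y)"
      by (simp add: beta_map_def algebra_simps)
    then show ?case using Suc by simp
  qed simp
  then show ?thesis by simp
qed

lemma beta_cylinder_dist_le:
  assumes "0 < \<beta>" "x \<in> {0..<1}" "y \<in> beta_cylinder \<beta> n (\<lambda>i. beta_digit \<beta> i x)"
  shows "\<bar>x - y\<bar> \<le> 1 / \<beta> ^ n"
proof -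
  have "y \<in> {0..<1}" using assms(3) by (simp add: beta_cylinder_def)
  then have "\<bar>\<beta> ^ n * (x - y)\<bar> \<le> 1"
    using beta_cylinder_diff[OF assms(3)] beta_iter_range[of x n \<beta>] beta_iter_range[of y n \<beta>] assms(2) by auto
  then have "\<beta> ^ n * \<bar>x - y\<bar> \<le> 1" using assms(1) unfolding abs_mult by simp
  then show ?thesis using assms(1) by (subst pos_le_divide_eq) (auto simp: mult.commute)
qed

text \<open>Lowering \<open>x\<close> by this amount lowers the \<open>k\<close>-th iterate by an
  amount that \<open>beta_iter_le\<close> bounds by the iterate itself, so no digit changes. The
  point is the left end of the cylinder, and its distance from \<open>x\<close> serves as a lower
  bound for the length, which for non-full cylinders can be far below
  \<open>1 / \<beta> ^ n\<close>.\<close>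

lemma beta_cylinder_left_end:
  assumes b: "1 < \<beta>" and x: "x \<in> {0..<1}"
  shows "x - (beta_map \<beta> ^^ n) x / \<beta> ^ n \<in> beta_cylinder \<beta> n (\<lambda>i. beta_digit \<beta> i x)"
proof -
  define t where "t = (beta_map \<beta> ^^ n) x"
  define y where "y = x - t / \<beta> ^ n"
  have t: "0 \<le> t" using beta_iter_range[OF x] by (auto simp: t_def)
  have pos: "0 < \<beta> ^ k" for k using b by simp
  have le: "t / \<beta> ^ n * \<beta> ^ k \<le> (beta_map \<beta> ^^ k) x" if "k \<le> n" for k
  proof -
    have "t \<le> \<beta> ^ (n - k) * (beta_map \<beta> ^^ k) x"
      using beta_iter_le[of \<beta> x k "n - k"] b x that by (simp add: t_def)
    moreover have "\<beta> ^ n = \<beta> ^ (n - k) * \<beta> ^ k" using that by (simp add: power_add[symmetric])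
    ultimately have "t / \<beta> ^ n * \<beta> ^ k = t / \<beta> ^ (n - k)" using b by simp
    also have "\<dots> \<le> (beta_map \<beta> ^^ k) x"
      using \<open>t \<le> \<beta> ^ (n - k) * (beta_map \<beta> ^^ k) x\<close> pos[of "n - k"] by (subst pos_divide_le_eq) (auto simp: mult.commute)
    finally show ?thesis .
  qed
  have iter: "(beta_map \<beta> ^^ k) y = (beta_map \<beta> ^^ k) x - t / \<beta> ^ n * \<beta> ^ k \<and>
      (\<forall>i<k. \<lfloor>\<beta> * (beta_map \<beta> ^^ i) y\<rfloor> = \<lfloor>\<beta> * (beta_map \<beta> ^^ i) x\<rfloor>)" if "k \<le> n" for k
    using that
  proof (induction k)
    case 0 then show ?case by (simp add: y_def)
  next
    case (Suc k)
    then have IH: "(beta_map \<beta> ^^ k) y = (beta_map \<beta> ^^ k) x - t / \<beta> ^ n * \<beta> ^ k"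
      "\<forall>i<k. \<lfloor>\<beta> * (beta_map \<beta> ^^ i) y\<rfloor> = \<lfloor>\<beta> * (beta_map \<beta> ^^ i) x\<rfloor>" by auto
    let ?u = "(beta_map \<beta> ^^ k) x" and ?v = "(beta_map \<beta> ^^ k) y"
    have v: "\<beta> * ?v = \<beta> * ?u - t / \<beta> ^ n * \<beta> ^ Suc k" unfolding IH(1) by (simp add: algebra_simps)
    have "t / \<beta> ^ n * \<beta> ^ Suc k \<le> \<beta> * ?u - of_int \<lfloor>\<beta> * ?u\<rfloor>"
      using le[OF Suc.prems] by (simp add: beta_map_def)
    moreover have "0 \<le> t / \<beta> ^ n * \<beta> ^ Suc k" using t b by simp
    ultimately have fl: "\<lfloor>\<beta> * ?v\<rfloor> = \<lfloor>\<beta> * ?u\<rfloor>" unfolding v by linarith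
    then have "beta_map \<beta> ?v = beta_map \<beta> ?u - t / \<beta> ^ n * \<beta> ^ Suc k"
      using v by (simp add: beta_map_def)
    then show ?case using fl IH(2) by (simp add: less_Suc_eq)
  qed
  have "0 \<le> t / \<beta> ^ n" using t pos[of n] by simp
  then have "y \<in> {0..<1}" using le[of 0] x by (auto simp: y_def)
  then show ?thesis using iter[of n] unfolding mem_beta_cylinder_iff y_def[symmetric] t_def[symmetric] by auto
qed

(* An induction on n alone fails: the orbit of the last, partial branch has to be followed, hence
   the parameter s. *)
lemma emeasure_beta_iter_less:
  assumes b: "1 < \<beta>" and "0 \<le> \<eta>" and "0 \<le> s" "s \<le> 1"
  shows "emeasure lebesgue {x. 0 \<le> x \<and> x < s \<and> (beta_map \<beta> ^^ n) x < \<eta>} \<le>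
    ennreal (\<eta> * (s * (\<Sum>k<n. 1 / \<beta> ^ k) + 1 / \<beta> ^ n))"
  using assms(3,4)
proof (induction n arbitrary: s)
  case 0
  have "emeasure lebesgue {x. 0 \<le> x \<and> x < s \<and> (beta_map \<beta> ^^ 0) x < \<eta>} \<le> emeasure lebesgue {0..\<eta>}"
    by (intro emeasure_mono) auto
  then show ?case using assms(2) by simp
next
  case (Suc n)
  define E where "E r = {x. 0 \<le> x \<and> x < r \<and> (beta_map \<beta> ^^ n) x < \<eta>}" for r
  define c where "c r = \<eta> * (r * (\<Sum>k<n. 1 / \<beta> ^ k) + 1 / \<beta> ^ n)" for r
  have c_nn: "0 \<le> c r" if "0 \<le> r" for r using that b \<open>0 \<le> \<eta>\<close> by (auto simp: c_def intro!: mult_nonneg_nonneg add_nonneg_nonneg sum_nonneg)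
  have borel_E: "E r \<in> sets borel" for r
  proof -
    have "(beta_map \<beta> ^^ n) \<in> borel_measurable borel" by measurable
    then show "E r \<in> sets borel" unfolding E_def by measurable
  qed
  \<comment> \<open>The inverse branch of \<open>beta_map\<close> that belongs to the digit
    \<open>j\<close>.\<close>
  define f where "f j x = (1 / \<beta>) *\<^sub>R x + real j / \<beta>" for j :: nat and x :: real
  have em: "emeasure lebesgue (f j ` E r) \<le> ennreal (1 / \<beta> * c r)" if "0 \<le> r" "r \<le> 1" for j r
  proof -
    have "emeasure lebesgue (f j ` E r) = ennreal \<bar>1 / \<beta>\<bar> * emeasure lebesgue (E r)"
      using emeasure_lebesgue_affine[of "1 / \<beta>" "real j / \<beta>" "E r"] by (simp add: f_def[abs_def])
    also have "\<dots> \<le> ennreal (1 / \<beta>) * ennreal (c r)"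
      using Suc.IH[of r] that b by (intro mult_mono) (auto simp: E_def c_def)
    also have "\<dots> = ennreal (1 / \<beta> * c r)" using c_nn[OF that(1)] b by (subst ennreal_mult) auto
    finally show ?thesis .
  qed
  have sets_f: "f j ` E r \<in> sets lebesgue" for j r
  proof -
    have "x \<in> f j ` E r" if "\<beta> * x - real j \<in> E r" for x
      using that b by (intro image_eqI[of _ _ "\<beta> * x - real j"]) (auto simp: f_def field_simps)
    moreover have "\<beta> * f j y - real j = y" for y using b by (simp add: f_def field_simps)
    ultimately have "f j ` E r = (\<lambda>x. \<beta> * x - real j) -` E r" by auto
    moreover have "(\<lambda>x. \<beta> * x - real j) -` E r \<in> sets borel"
      by (rule measurable_sets_borel[OF _ borel_E]) simp
    ultimately show ?thesis by simp
  qed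
  \<comment> \<open>Below \<open>s\<close> there are \<open>J\<close> full branches, followed by one
    whose image is cut off at \<open>r\<close>.\<close>
  define J where "J = nat \<lfloor>\<beta> * s\<rfloor>"
  define r where "r = \<beta> * s - of_int \<lfloor>\<beta> * s\<rfloor>"
  have "0 \<le> \<beta> * s" using b Suc.prems by simp
  then have J: "real J = of_int \<lfloor>\<beta> * s\<rfloor>" by (simp add: J_def)
  have r: "0 \<le> r" "r \<le> 1" "\<beta> * s = real J + r" unfolding J r_def by linarith+
  have "{x. 0 \<le> x \<and> x < s \<and> (beta_map \<beta> ^^ Suc n) x < \<eta>} \<subseteq> (\<Union>j<J. f j ` E 1) \<union> f J ` E r"
  proof
    fix x assume x: "x \<in> {x. 0 \<le> x \<and> x < s \<and> (beta_map \<beta> ^^ Suc n) x < \<eta>}"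
    define j where "j = nat \<lfloor>\<beta> * x\<rfloor>"
    have x0: "0 \<le> \<beta> * x" "\<beta> * x < \<beta> * s" using x b by auto
    then have j: "real j = of_int \<lfloor>\<beta> * x\<rfloor>" by (simp add: j_def)
    then have bx: "beta_map \<beta> x = \<beta> * x - real j" by (simp add: beta_map_def)
    then have fx: "f j (beta_map \<beta> x) = x" using b by (simp add: f_def field_simps)
    have iter: "(beta_map \<beta> ^^ n) (beta_map \<beta> x) < \<eta>" using x by (simp add: funpow_swap1)
    have rg: "0 \<le> beta_map \<beta> x" "beta_map \<beta> x < 1" using beta_map_range[of \<beta> x] by auto
    have "j \<le> J" using x0 by (simp add: j_def J_def floor_mono nat_mono)
    then show "x \<in> (\<Union>j<J. f j ` E 1) \<union> f J ` E r"
    proof (cases "j = J")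
      case True
      then have "beta_map \<beta> x < r" using bx x0 r by simp
      then have "beta_map \<beta> x \<in> E r" using iter rg by (simp add: E_def)
      then show ?thesis using fx True by (metis UnI2 imageI)
    next
      case False
      then have "j \<in> {..<J}" using \<open>j \<le> J\<close> by simp
      moreover have "beta_map \<beta> x \<in> E 1" using iter rg by (simp add: E_def)
      ultimately show ?thesis using fx by (metis UN_I UnI1 imageI)
    qed
  qed
  then have "emeasure lebesgue {x. 0 \<le> x \<and> x < s \<and> (beta_map \<beta> ^^ Suc n) x < \<eta>}
      \<le> emeasure lebesgue ((\<Union>j<J. f j ` E 1) \<union> f J ` E r)"
    by (rule emeasure_mono) (intro sets.Un sets.finite_UN sets_f; simp)
  also have "\<dots> \<le> emeasure lebesgue (\<Union>j<J. f j ` E 1) + emeasure lebesgue (f J ` E r)"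
    by (intro emeasure_subadditive sets.finite_UN sets_f) auto
  also have "\<dots> \<le> (\<Sum>j<J. ennreal (1 / \<beta> * c 1)) + ennreal (1 / \<beta> * c r)"
  proof (intro add_mono em r order_refl)
    have "emeasure lebesgue (\<Union>j<J. f j ` E 1) \<le> (\<Sum>j<J. emeasure lebesgue (f j ` E 1))"
      by (rule emeasure_subadditive_finite) (auto simp: sets_f)
    also have "\<dots> \<le> (\<Sum>j<J. ennreal (1 / \<beta> * c 1))" by (intro sum_mono em) auto
    finally show "emeasure lebesgue (\<Union>j<J. f j ` E 1) \<le> (\<Sum>j<J. ennreal (1 / \<beta> * c 1))" .
  qed
  also have "\<dots> = ennreal (real J * (1 / \<beta> * c 1) + 1 / \<beta> * c r)"
    using c_nn[of 1] c_nn[of r] b r by (subst sum_ennreal) (auto simp: ennreal_plus[symmetric] simp del: ennreal_plus)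
  also have "\<dots> \<le> ennreal (\<eta> * (s * (\<Sum>k<Suc n. 1 / \<beta> ^ k) + 1 / \<beta> ^ Suc n))"
  proof (rule ennreal_leI)
    define A where "A = (\<Sum>k<n. 1 / \<beta> ^ k)"
    have A: "0 \<le> A" using b by (auto simp: A_def intro: sum_nonneg)
    define q where "q = 1 / \<beta> ^ n"
    have q: "0 \<le> q" "1 / \<beta> ^ Suc n = q / \<beta>" using b by (simp_all add: q_def)
    \<comment> \<open>In the first term \<open>real J + r\<close> is exactly
      \<open>\<beta> * s\<close>; only the second is estimated, by
      \<open>real J \<le> \<beta> * s\<close>.\<close>
    have "real J * (1 / \<beta> * c 1) + 1 / \<beta> * c r = \<eta> * (((real J + r) * A + (real J + 1) * q) / \<beta>)"
      unfolding c_def A_def[symmetric] q_def[symmetric] by (simp add: algebra_simps add_divide_distrib)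
    also have "\<dots> \<le> \<eta> * (((\<beta> * s) * A + (\<beta> * s + 1) * q) / \<beta>)"
      using r q b A \<open>0 \<le> \<eta>\<close> by (intro mult_left_mono divide_right_mono add_mono mult_right_mono) auto
    also have "\<dots> = \<eta> * (s * (A + q) + q / \<beta>)" using b by (simp add: field_simps)
    finally show "real J * (1 / \<beta> * c 1) + 1 / \<beta> * c r \<le> \<eta> * (s * (\<Sum>k<Suc n. 1 / \<beta> ^ k) + 1 / \<beta> ^ Suc n)"
      unfolding q(2) sum.lessThan_Suc A_def[symmetric] q_def[symmetric] .
  qed
  finally show ?case .
qed

section \<open>Comparison of the two expansions\<close>

lemma measurable_count_space_pair:
  fixes f :: "'a \<Rightarrow> 'b::countable" and g :: "'a \<Rightarrow> 'c::countable"
  assumes f: "f \<in> measurable M (count_space UNIV)" and g: "g \<in> measurable M (count_space UNIV)"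
  shows "(\<lambda>x. h (f x) (g x)) \<in> measurable M (count_space UNIV)"
proof -
  have "(\<lambda>x. h a (g x)) \<in> measurable M (count_space UNIV)" for a
    using measurable_compose[OF g, of "h a" "count_space UNIV"] by simp
  from measurable_compose_countable[OF this f] show ?thesis .
qed

lemma measurable_map_count_space:
  fixes f :: "'i \<Rightarrow> 'a \<Rightarrow> 'b::countable"
  assumes "\<And>i. f i \<in> measurable M (count_space UNIV)"
  shows "(\<lambda>x. map (\<lambda>i. f i x) xs) \<in> measurable M (count_space UNIV)"
proof (induction xs)
  case (Cons i js)
  from measurable_count_space_pair[OF assms[of i] this, of "(#)"] show ?case by simp
qed simp

lemma beta_digit_measurable: "beta_digit \<beta> i \<in> measurable borel (count_space UNIV)"
  unfolding beta_digit_def[abs_def] by measurable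

lemma cf_quot_measurable: "cf_quot j \<in> measurable borel (count_space UNIV)"
  unfolding cf_quot_def[abs_def] by measurable

text \<open>Both cylinders depend on \<open>x\<close> only through finitely many integers. Coded as
  lists these take values in a countable type, where any relation whatever is measurable; so
  inclusion of cylinders needs no analysis.\<close>

lemma cf_digits_known_measurable: "cf_digits_known \<beta> n \<in> measurable borel (count_space UNIV)"
proof -
  define b where "b x = map (\<lambda>i. beta_digit \<beta> i x) [1..<Suc n]" for x
  define a where "a m x = map (\<lambda>j. cf_quot j x) [1..<Suc m]" for m x
  have J: "beta_cylinder \<beta> n (\<lambda>i. beta_digit \<beta> i x) = beta_cylinder \<beta> n (\<lambda>i. b x ! (i - 1))" for x
    unfolding beta_cylinder_def b_def by (auto simp del: upt_Suc)
  have I: "cf_cylinder m (\<lambda>j. cf_quot j x) = cf_cylinder m (\<lambda>j. a m x ! (j - 1))" for m x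
    unfolding cf_cylinder_def a_def by (auto simp del: upt_Suc)
  have "b \<in> measurable borel (count_space UNIV)"
    unfolding b_def[abs_def] by (rule measurable_map_count_space[OF beta_digit_measurable])
  moreover have "a m \<in> measurable borel (count_space UNIV)" for m
    unfolding a_def[abs_def] by (rule measurable_map_count_space[OF cf_quot_measurable])
  ultimately have "(\<lambda>x. beta_cylinder \<beta> n (\<lambda>i. b x ! (i - 1)) \<subseteq> cf_cylinder m (\<lambda>j. a m x ! (j - 1)))
      \<in> measurable borel (count_space UNIV)" for m
    by (rule measurable_count_space_pair[where h = "\<lambda>bs as. beta_cylinder \<beta> n (\<lambda>i. bs ! (i - 1)) \<subseteq> cf_cylinder m (\<lambda>j. as ! (j - 1))"])
  then show ?thesis unfolding cf_digits_known_def[abs_def] J I by (intro measurable_Sup_nat) simp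
qed

lemma deviation_set_borel: "deviation_set \<beta> \<epsilon> n \<in> sets borel"
proof -
  define Q where "Q = {k. \<epsilon> \<le> \<bar>real k / real n - 6 * ln 2 * ln \<beta> / pi\<^sup>2\<bar>}"
  have rat: "\<rat> \<in> sets (borel :: real measure)" by (rule sets.countable[OF _ countable_rat]) simp
  have known: "cf_digits_known \<beta> n -` Q \<in> sets borel"
    using measurable_sets[OF cf_digits_known_measurable, of Q \<beta> n] by simp
  have "deviation_set \<beta> \<epsilon> n = ({0..<1} - \<rat>) \<inter> cf_digits_known \<beta> n -` Q"
    unfolding deviation_set_def Q_def by blast
  then show ?thesis using rat known by (metis sets.Diff sets.Int atLeastLessThan_borel)
qed

section \<open>Known partial quotients and Birkhoff sums\<close>

lemma orbit_prod_eq_exp: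
  assumes "x \<in> {0..<1}" "x \<notin> \<rat>" shows "orbit_prod m x = exp (- birkhoff_ln m x)"
  using gauss_iter_pos[OF assms] by (simp add: orbit_prod_def birkhoff_ln_def sum_negf exp_sum)

text \<open>The upper bound for distances within a continued fraction cylinder, applied to
  \<open>x\<close> and the left end of its beta cylinder.\<close>

lemma beta_cylinder_subset_imp:
  assumes b: "1 < \<beta>" and x: "x \<in> {0..<1}" "x \<notin> \<rat>"
    and sub: "beta_cylinder \<beta> n (\<lambda>i. beta_digit \<beta> i x) \<subseteq> cf_cylinder m (\<lambda>j. cf_quot j x)"
  shows "(beta_map \<beta> ^^ n) x / \<beta> ^ n \<le> 2 * (orbit_prod m x)\<^sup>2"
proof -
  let ?y = "x - (beta_map \<beta> ^^ n) x / \<beta> ^ n"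
  have "?y \<in> {0..<1}" "cf_agree m x ?y"
    using sub beta_cylinder_left_end[OF b x(1), of n] cf_cylinder_iff[OF x] by blast+
  from abs_diff_cf_agree_le[OF x(1) this]
  have "\<bar>(beta_map \<beta> ^^ n) x / \<beta> ^ n\<bar> \<le> 2 * (orbit_prod m x)\<^sup>2" by (simp only: diff_diff_eq2 add_diff_cancel_left')
  then show ?thesis by linarith
qed

text \<open>The set under the supremum is closed downwards and finite: continued fraction cylinders
  shrink by \<open>orbit_prod_even_le\<close>, while the beta cylinder has positive length to the
  left of \<open>x\<close>. Hence the supremum is attained.\<close>

lemma le_cf_digits_known_iff:
  assumes b: "1 < \<beta>" and x: "x \<in> {0..<1}" "x \<notin> \<rat>" and pos: "0 < (beta_map \<beta> ^^ n) x"
  shows "m \<le> cf_digits_known \<beta> n x \<longleftrightarrow>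
    beta_cylinder \<beta> n (\<lambda>i. beta_digit \<beta> i x) \<subseteq> cf_cylinder m (\<lambda>j. cf_quot j x)"
proof -
  define K where "K = {m. beta_cylinder \<beta> n (\<lambda>i. beta_digit \<beta> i x) \<subseteq> cf_cylinder m (\<lambda>j. cf_quot j x)}"
  have 0: "0 \<in> K" by (auto simp: K_def beta_cylinder_def cf_cylinder_def)
  have down: "i \<in> K" if "j \<in> K" "i \<le> j" for i j
    using that by (auto simp: K_def cf_cylinder_iff[OF x] cf_agree_def subset_iff)
  have "finite K"
  proof (rule ccontr)
    assume "infinite K"
    then have K: "j \<in> K" for j using down by (meson finite_nat_set_iff_bounded not_less)
    let ?t = "(beta_map \<beta> ^^ n) x / \<beta> ^ n"
    have "?t / 2 \<le> (1 / 4) ^ j" for j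
    proof -
      have "?t \<le> 2 * (orbit_prod (2 * j) x)\<^sup>2"
        using K[of "2 * j"] by (intro beta_cylinder_subset_imp[OF b x]) (simp add: K_def)
      also have "(orbit_prod (2 * j) x)\<^sup>2 \<le> ((1 / 2) ^ j)\<^sup>2"
        using orbit_prod_even_le[OF x(1)] orbit_prod_nonneg[OF x(1)] by (intro power_mono) auto
      also have "((1 / 2 :: real) ^ j)\<^sup>2 = (1 / 4) ^ j" by (simp add: power_mult_distrib[symmetric] power2_eq_square)
      finally show ?thesis by simp
    qed
    moreover have "(\<lambda>j. (1 / 4 :: real) ^ j) \<longlonglongrightarrow> 0" by (rule LIMSEQ_realpow_zero) auto
    ultimately have "?t / 2 \<le> 0" by (intro LIMSEQ_le_const) auto
    moreover have "0 < ?t" using pos b by simp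
    ultimately show False by simp
  qed
  then have "cf_digits_known \<beta> n x \<in> K" "\<And>j. j \<in> K \<Longrightarrow> j \<le> cf_digits_known \<beta> n x"
    using Max_in[of K] 0 by (auto simp: cf_digits_known_def K_def[symmetric] Sup_nat_def)
  then have "m \<le> cf_digits_known \<beta> n x \<longleftrightarrow> m \<in> K" using down by blast
  then show ?thesis by (simp add: K_def)
qed

text \<open>The inclusion of cylinders in logarithmic form; \<open>r\<close> measures how short the
  beta cylinder may be to the left of \<open>x\<close>.\<close>

lemma birkhoff_ln_le:
  assumes b: "1 < \<beta>" and x: "x \<in> {0..<1}" "x \<notin> \<rat>" and t: "exp (- r) \<le> (beta_map \<beta> ^^ n) x"
    and sub: "beta_cylinder \<beta> n (\<lambda>i. beta_digit \<beta> i x) \<subseteq> cf_cylinder m (\<lambda>j. cf_quot j x)"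
  shows "2 * birkhoff_ln m x \<le> ln 2 + real n * ln \<beta> + r"
proof -
  have pw: "\<beta> ^ n = exp (real n * ln \<beta>)" using b by (simp add: exp_of_nat_mult)
  have "exp (- r - real n * ln \<beta>) = exp (- r) / \<beta> ^ n" by (simp add: exp_diff pw)
  also have "\<dots> \<le> (beta_map \<beta> ^^ n) x / \<beta> ^ n" using t b by (intro divide_right_mono) auto
  also have "\<dots> \<le> 2 * (orbit_prod m x)\<^sup>2" by (rule beta_cylinder_subset_imp[OF b x sub])
  also have "\<dots> = exp (ln 2 - 2 * birkhoff_ln m x)"
    by (simp add: orbit_prod_eq_exp[OF x] exp_diff exp_minus exp_double field_simps)
  finally show ?thesis by simp
qed

text \<open>A point \<open>z\<close> of the beta cylinder outside the continued fraction cylinder is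
  within \<open>1 / \<beta> ^ n\<close> of \<open>x\<close>, but by
  \<open>abs_diff_not_cf_agree_ge\<close> not too close to it.\<close>

lemma birkhoff_ln_ge:
  assumes b: "1 < \<beta>" and x: "x \<in> {0..<1}" "x \<notin> \<rat>"
    and far: "\<And>j. j \<le> m \<Longrightarrow> exp (- r) \<le> (gauss_map ^^ j) x \<and> (gauss_map ^^ j) x \<le> 1 - exp (- r)"
    and sub: "\<not> beta_cylinder \<beta> n (\<lambda>i. beta_digit \<beta> i x) \<subseteq> cf_cylinder m (\<lambda>j. cf_quot j x)"
  shows "real n * ln \<beta> - r - ln 4 \<le> 2 * birkhoff_ln m x"
proof -
  have pw: "\<beta> ^ n = exp (real n * ln \<beta>)" using b by (simp add: exp_of_nat_mult)
  obtain z where z: "z \<in> beta_cylinder \<beta> n (\<lambda>i. beta_digit \<beta> i x)" "z \<notin> cf_cylinder m (\<lambda>j. cf_quot j x)"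
    using sub by blast
  then have z01: "z \<in> {0..<1}" by (simp add: beta_cylinder_def)
  then have "\<not> cf_agree m x z" using z(2) cf_cylinder_iff[OF x] by blast
  have "exp (- (2 * birkhoff_ln m x) - r - ln 4) = (orbit_prod m x)\<^sup>2 * exp (- r) / 4"
    by (simp add: orbit_prod_eq_exp[OF x] exp_diff exp_minus exp_double exp_add field_simps)
  also have "\<dots> \<le> \<bar>x - z\<bar>"
    by (rule abs_diff_not_cf_agree_ge[OF x z01 \<open>\<not> cf_agree m x z\<close> _ far]) auto
  also have "\<dots> \<le> 1 / \<beta> ^ n" using b by (intro beta_cylinder_dist_le[OF _ x(1) z(1)]) auto
  also have "\<dots> = exp (- (real n * ln \<beta>))" by (simp add: pw exp_minus inverse_eq_divide)
  finally show ?thesis by simp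
qed

section \<open>Families of sets of exponentially small measure\<close>

definition exp_small :: "(nat \<Rightarrow> real set) \<Rightarrow> bool" where
  "exp_small E \<longleftrightarrow> (\<exists>A>0. \<exists>\<alpha>>0. \<forall>n. E n \<in> sets borel \<and> emeasure lborel (E n) \<le> ennreal (A * exp (- \<alpha> * real n)))"

lemma exp_small_Un:
  assumes "exp_small E" "exp_small F" shows "exp_small (\<lambda>n. E n \<union> F n)"
proof -
  obtain A \<alpha> where A: "0 < A" "0 < \<alpha>" "\<And>n. E n \<in> sets borel" "\<And>n. emeasure lborel (E n) \<le> ennreal (A * exp (- \<alpha> * real n))"
    using assms(1) by (auto simp: exp_small_def)
  obtain B \<gamma> where B: "0 < B" "0 < \<gamma>" "\<And>n. F n \<in> sets borel" "\<And>n. emeasure lborel (F n) \<le> ennreal (B * exp (- \<gamma> * real n))"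
    using assms(2) by (auto simp: exp_small_def)
  define \<mu> where "\<mu> = min \<alpha> \<gamma>"
  have "emeasure lborel (E n \<union> F n) \<le> ennreal ((A + B) * exp (- \<mu> * real n))" for n
  proof -
    have "emeasure lborel (E n \<union> F n) \<le> emeasure lborel (E n) + emeasure lborel (F n)"
      using A(3) B(3) by (intro emeasure_subadditive) auto
    also have "\<dots> \<le> ennreal (A * exp (- \<alpha> * real n)) + ennreal (B * exp (- \<gamma> * real n))"
      by (intro add_mono A B)
    also have "\<dots> \<le> ennreal (A * exp (- \<mu> * real n)) + ennreal (B * exp (- \<mu> * real n))"
      using A(1) B(1) by (intro add_mono ennreal_leI mult_left_mono) (auto simp: \<mu>_def mult_right_mono)
    also have "\<dots> = ennreal ((A + B) * exp (- \<mu> * real n))"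
      using A(1) B(1) by (subst ennreal_plus[symmetric]) (auto simp: distrib_right)
    finally show ?thesis .
  qed
  then show ?thesis unfolding exp_small_def using A B
    by (intro exI[of _ "A + B"] conjI exI[of _ \<mu>] allI) (auto simp: \<mu>_def)
qed

lemma exp_small_reindex:
  assumes "exp_small E" "0 < \<kappa>" "\<And>n. \<kappa> * real n \<le> real (m n)"
  shows "exp_small (\<lambda>n. E (m n))"
proof -
  obtain A \<alpha> where A: "0 < A" "0 < \<alpha>" "\<And>n. E n \<in> sets borel" "\<And>n. emeasure lborel (E n) \<le> ennreal (A * exp (- \<alpha> * real n))"
    using assms(1) by (auto simp: exp_small_def)
  have "emeasure lborel (E (m n)) \<le> ennreal (A * exp (- (\<alpha> * \<kappa>) * real n))" for n
  proof -
    have "\<alpha> * (\<kappa> * real n) \<le> \<alpha> * real (m n)" using assms(3) A by (intro mult_left_mono) auto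
    then have "ennreal (A * exp (- \<alpha> * real (m n))) \<le> ennreal (A * exp (- (\<alpha> * \<kappa>) * real n))"
      using A by (intro ennreal_leI mult_left_mono) (auto simp: mult.assoc)
    then show ?thesis using A(4) order_trans by blast
  qed
  then show ?thesis unfolding exp_small_def using A assms(2)
    by (intro exI[of _ A] conjI exI[of _ "\<alpha> * \<kappa>"] allI) auto
qed

text \<open>For the finitely many early indices the measure is at most 1, which the summand
  \<open>exp (\<alpha> * real n0)\<close> in the constant absorbs.\<close>

lemma exp_small_eventually_subset:
  assumes "exp_small E" "\<And>n. n \<ge> n0 \<Longrightarrow> D n \<subseteq> E n" "\<And>n. D n \<in> sets borel" "\<And>n. D n \<subseteq> {0..<1}"
  shows "exp_small D"
proof -
  obtain A \<alpha> where A: "0 < A" "0 < \<alpha>" "\<And>n. E n \<in> sets borel" "\<And>n. emeasure lborel (E n) \<le> ennreal (A * exp (- \<alpha> * real n))"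
    using assms(1) by (auto simp: exp_small_def)
  have "emeasure lborel (D n) \<le> ennreal ((A + exp (\<alpha> * real n0)) * exp (- \<alpha> * real n))" for n
  proof (cases "n \<ge> n0")
    case True
    have "emeasure lborel (D n) \<le> emeasure lborel (E n)" using assms(2)[OF True] A(3) by (intro emeasure_mono) auto
    also have "\<dots> \<le> ennreal (A * exp (- \<alpha> * real n))" by (rule A)
    also have "\<dots> \<le> ennreal ((A + exp (\<alpha> * real n0)) * exp (- \<alpha> * real n))"
      by (intro ennreal_leI mult_right_mono) auto
    finally show ?thesis .
  next
    case False
    have "emeasure lborel (D n) \<le> emeasure lborel {0..<1::real}" using assms(4) by (intro emeasure_mono) auto
    also have "\<dots> = ennreal 1" by simp
    also have "\<dots> \<le> ennreal ((A + exp (\<alpha> * real n0)) * exp (- \<alpha> * real n))"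
    proof (rule ennreal_leI)
      have "1 \<le> exp (\<alpha> * real n0) * exp (- \<alpha> * real n)"
        using False A by (simp add: exp_add[symmetric])
      also have "\<dots> \<le> (A + exp (\<alpha> * real n0)) * exp (- \<alpha> * real n)" using A by (intro mult_right_mono) auto
      finally show "1 \<le> (A + exp (\<alpha> * real n0)) * exp (- \<alpha> * real n)" .
    qed
    finally show ?thesis .
  qed
  then show ?thesis unfolding exp_small_def using A assms(3)
    by (intro exI[of _ "A + exp (\<alpha> * real n0)"] conjI exI[of _ \<alpha>] allI) (auto simp: add_pos_pos)
qed

lemma exp_small_beta_iter:
  assumes b: "1 < \<beta>" and "0 < \<delta>"
  shows "exp_small (\<lambda>n. {x. 0 \<le> x \<and> x < 1 \<and> (beta_map \<beta> ^^ n) x < exp (- \<delta> * real n)})"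
proof -
  have "{x. 0 \<le> x \<and> x < 1 \<and> (beta_map \<beta> ^^ n) x < exp (- \<delta> * real n)} \<in> sets borel" for n
  proof -
    have "(beta_map \<beta> ^^ n) \<in> borel_measurable borel" by measurable
    then show ?thesis by measurable
  qed
  moreover have "emeasure lborel {x. 0 \<le> x \<and> x < 1 \<and> (beta_map \<beta> ^^ n) x < exp (- \<delta> * real n)}
      \<le> ennreal ((1 / (1 - 1 / \<beta>) + 1) * exp (- \<delta> * real n))" for n
  proof -
    have "{x. 0 \<le> x \<and> x < 1 \<and> (beta_map \<beta> ^^ n) x < exp (- \<delta> * real n)} \<in> sets borel" by fact
    then have "emeasure lborel {x. 0 \<le> x \<and> x < 1 \<and> (beta_map \<beta> ^^ n) x < exp (- \<delta> * real n)}
      \<le> ennreal (exp (- \<delta> * real n) * (1 * (\<Sum>k<n. 1 / \<beta> ^ k) + 1 / \<beta> ^ n))"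
      using emeasure_beta_iter_less[OF b, of "exp (- \<delta> * real n)" 1 n] by simp
    also have "\<dots> \<le> ennreal (exp (- \<delta> * real n) * (1 / (1 - 1 / \<beta>) + 1))"
    proof (intro ennreal_leI mult_left_mono add_mono)
      have "(\<Sum>k<n. (1 / \<beta>) ^ k) \<le> (\<Sum>k. (1 / \<beta>) ^ k)" using b by (intro sum_le_suminf summable_geometric) auto
      also have "\<dots> = 1 / (1 - 1 / \<beta>)" using b by (intro suminf_geometric) auto
      finally show "1 * (\<Sum>k<n. 1 / \<beta> ^ k) \<le> 1 / (1 - 1 / \<beta>)" by (simp add: power_divide)
      show "1 / \<beta> ^ n \<le> 1" using b by simp
    qed auto
    finally show ?thesis by (simp add: mult.commute)
  qed
  moreover have "0 < 1 / (1 - 1 / \<beta>) + 1" using b by (intro add_pos_pos) auto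
  ultimately show ?thesis unfolding exp_small_def using assms(2)
    by (intro exI[of _ "1 / (1 - 1 / \<beta>) + 1"] conjI exI[of _ \<delta>] allI) auto
qed

lemma exp_small_birkhoff_ln:
  assumes "0 < \<delta>"
  shows "exp_small (\<lambda>m. {x. 0 \<le> x \<and> x < 1 \<and> \<delta> * real m \<le> \<bar>birkhoff_ln m x - levy_constant * real m\<bar>})"
proof -
  obtain A \<alpha> where A: "0 < A" "0 < \<alpha>" and
    le: "\<And>m. emeasure gauss_measure {x. \<delta> * real m \<le> \<bar>birkhoff_ln m x - levy_constant * real m\<bar>}
       \<le> ennreal (A * exp (- \<alpha> * real m))"
    using birkhoff_ln_large_deviations[OF assms] by metis
  define E where "E m = {x. 0 \<le> x \<and> x < 1 \<and> \<delta> * real m \<le> \<bar>birkhoff_ln m x - levy_constant * real m\<bar>}" for m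
  have E[measurable]: "E m \<in> sets borel" for m unfolding E_def by measurable
  have "emeasure lborel (E m) \<le> ennreal (2 * A * exp (- \<alpha> * real m))" for m
  proof -
    have "emeasure lborel (E m) \<le> 2 * emeasure gauss_measure (E m)"
      by (rule emeasure_lborel_le_gauss_measure[OF E]) (auto simp: E_def)
    also have "emeasure gauss_measure (E m) \<le> emeasure gauss_measure {x. \<delta> * real m \<le> \<bar>birkhoff_ln m x - levy_constant * real m\<bar>}"
      by (rule emeasure_mono) (auto simp: E_def)
    also have "\<dots> \<le> ennreal (A * exp (- \<alpha> * real m))" by (rule le)
    also have "2 * \<dots> = ennreal (2 * A * exp (- \<alpha> * real m))" using A by (simp add: ennreal_mult mult.assoc)
    finally show ?thesis by (simp add: mult_left_mono)
  qed
  then have "exp_small E" unfolding exp_small_def using A E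
    by (intro exI[of _ "2 * A"] conjI exI[of _ \<alpha>] allI) auto
  then show ?thesis by (simp add: E_def[abs_def])
qed

text \<open>By invariance each iterate is near the ends with the same small probability; a union
  bound over linearly many iterates follows.\<close>

lemma exp_small_gauss_near_ends:
  assumes "0 < \<delta>" "0 < \<kappa>" "\<And>n. real (m n) \<le> \<kappa> * real n + 1"
  shows "exp_small (\<lambda>n. {x. 0 \<le> x \<and> x < 1 \<and> (\<exists>j\<le>m n. (gauss_map ^^ j) x < exp (- \<delta> * real n) \<or>
     1 - exp (- \<delta> * real n) < (gauss_map ^^ j) x)})"
proof -
  define \<eta> where "\<eta> n = exp (- \<delta> * real n)" for n
  define V where "V n = {..<\<eta> n} \<union> {1 - \<eta> n<..}" for n
  have V[measurable]: "V n \<in> sets borel" for n by (simp add: V_def)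
  define R where "R n = {x. 0 \<le> x \<and> x < 1 \<and> (\<exists>j\<le>m n. (gauss_map ^^ j) x \<in> V n)}" for n
  have R_eq: "R n = {0..<1} \<inter> (\<Union>j\<le>m n. (gauss_map ^^ j) -` V n)" for n by (auto simp: R_def)
  have vim: "(gauss_map ^^ j) -` V n \<in> sets borel" for j n
    by (rule measurable_sets_borel[OF _ V]) measurable
  have R[measurable]: "R n \<in> sets borel" for n unfolding R_eq using vim by auto
  have GV: "emeasure gauss_measure (V n) \<le> ennreal (2 * \<eta> n)" for n
  proof -
    have "emeasure gauss_measure (V n) = emeasure gauss_measure (V n \<inter> {0..<1})"
    proof (rule emeasure_eq_AE)
      show "AE x in gauss_measure. x \<in> V n \<longleftrightarrow> x \<in> V n \<inter> {0..<1}"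
        using AE_gauss_measure by eventually_elim auto
    qed auto
    also have "\<dots> \<le> emeasure lborel (V n \<inter> {0..<1})" by (rule emeasure_gauss_measure_le) measurable
    also have "\<dots> \<le> emeasure lborel ({0..\<eta> n} \<union> {1 - \<eta> n..1})" by (rule emeasure_mono) (auto simp: V_def)
    also have "\<dots> \<le> emeasure lborel {0..\<eta> n} + emeasure lborel {1 - \<eta> n..1}" by (rule emeasure_subadditive) auto
    also have "\<dots> = ennreal (2 * \<eta> n)" by (simp add: \<eta>_def ennreal_plus[symmetric] del: ennreal_plus)
    finally show ?thesis .
  qed
  have le: "emeasure lborel (R n) \<le> ennreal ((12 + 8 * \<kappa> / \<delta>) * exp (- (\<delta> / 2) * real n))" for n
  proof -
    have "emeasure lborel (R n) \<le> 2 * emeasure gauss_measure (R n)"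
      by (rule emeasure_lborel_le_gauss_measure[OF R]) (auto simp: R_def)
    also have "emeasure gauss_measure (R n) \<le> emeasure gauss_measure (\<Union>j\<le>m n. (gauss_map ^^ j) -` V n)"
      using vim by (intro emeasure_mono) (auto simp: R_eq)
    also have "\<dots> \<le> (\<Sum>j\<le>m n. emeasure gauss_measure ((gauss_map ^^ j) -` V n))"
      using vim by (intro emeasure_subadditive_finite) auto
    also have "\<dots> \<le> (\<Sum>j\<le>m n. ennreal (2 * \<eta> n))"
      using GV[of n] by (intro sum_mono) (simp add: emeasure_gauss_map_vimage[OF V])
    also have "\<dots> = ennreal (real (m n + 1) * (2 * \<eta> n))"
      by (subst sum_ennreal) (auto simp: \<eta>_def add.commute)
    also have "2 * \<dots> = ennreal (2 * (real (m n + 1) * (2 * \<eta> n)))"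
      by (subst ennreal_mult) (auto simp: \<eta>_def)
    also have "\<dots> \<le> ennreal ((12 + 8 * \<kappa> / \<delta>) * exp (- (\<delta> / 2) * real n))"
    proof (rule ennreal_leI)
      \<comment> \<open>The constant is chosen so that \<open>1 + z \<le> exp z\<close> with
        \<open>z = \<delta> / 2 * real n\<close> absorbs the number of iterates at the cost of half
        the rate.\<close>
      have "2 * (real (m n + 1) * 2) \<le> (12 + 8 * \<kappa> / \<delta>) * (1 + \<delta> / 2 * real n)"
      proof -
        have "(12 + 8 * \<kappa> / \<delta>) * (1 + \<delta> / 2 * real n) = 12 + 8 * \<kappa> / \<delta> + 6 * \<delta> * real n + 4 * \<kappa> * real n"
          using assms(1) by (simp add: field_simps)
        moreover have "0 \<le> 8 * \<kappa> / \<delta>" "0 \<le> 6 * \<delta> * real n" using assms by auto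
        ultimately show ?thesis using assms(3)[of n] by simp
      qed
      also have "\<dots> \<le> (12 + 8 * \<kappa> / \<delta>) * exp (\<delta> / 2 * real n)"
        using assms by (intro mult_left_mono exp_ge_add_one_self) auto
      finally have "2 * (real (m n + 1) * 2) * \<eta> n \<le> (12 + 8 * \<kappa> / \<delta>) * exp (\<delta> / 2 * real n) * \<eta> n"
        by (rule mult_right_mono) (simp add: \<eta>_def)
      also have "\<dots> = (12 + 8 * \<kappa> / \<delta>) * exp (- (\<delta> / 2) * real n)"
        by (simp add: \<eta>_def mult.assoc exp_add[symmetric])
      finally show "2 * (real (m n + 1) * (2 * \<eta> n)) \<le> (12 + 8 * \<kappa> / \<delta>) * exp (- (\<delta> / 2) * real n)"
        by (simp only: mult.assoc)
    qed
    finally show ?thesis by (simp add: mult_left_mono)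
  qed
  have "exp_small R" unfolding exp_small_def using le R assms
    by (intro exI[of _ "12 + 8 * \<kappa> / \<delta>"] conjI exI[of _ "\<delta> / 2"] allI) (auto simp: add_pos_nonneg)
  then show ?thesis by (simp add: R_def[abs_def] V_def \<eta>_def)
qed

text \<open>Off the exceptional sets, too many known quotients contradict
  \<open>birkhoff_ln_le\<close> at order \<open>m n\<close>, and too few contradict
  \<open>birkhoff_ln_ge\<close> at order \<open>l n\<close>.\<close>

lemma deviation_set_exp_small:
  assumes b: "1 < \<beta>" and "0 < \<epsilon>"
  shows "exp_small (deviation_set \<beta> \<epsilon>)"
proof -
  define \<gamma> where "\<gamma> = levy_constant"
  define c where "c = ln \<beta> / (2 * \<gamma>)"
  have \<gamma>: "0 < \<gamma>" using levy_constant_pos by (simp add: \<gamma>_def)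
  have c: "0 < c" "2 * \<gamma> * c = ln \<beta>" using b \<gamma> by (simp_all add: c_def)
  have c_eq: "6 * ln 2 * ln \<beta> / pi\<^sup>2 = c" by (simp add: c_def \<gamma>_def levy_constant_def)
  \<comment> \<open>Keeping \<open>e\<close> below \<open>c\<close> lets the lower order
    \<open>l n\<close> grow linearly.\<close>
  define e where "e = min \<epsilon> (c / 2)"
  have e: "0 < e" "e \<le> \<epsilon>" "e < c" using assms c by (auto simp: e_def)
  \<comment> \<open>The budget: shifting the order by \<open>e * n\<close> changes twice the
    expected Birkhoff sum by \<open>4 * \<delta> * n\<close>. Its fluctuation takes at most
    \<open>2 * \<delta> * n\<close> and the uncertainty of the cylinder sizes
    \<open>\<delta> * n\<close>; the rest beats the constants for large \<open>n\<close>.\<close>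
  define \<delta> where "\<delta> = \<gamma> * e / 2"
  define \<delta>' where "\<delta>' = \<gamma> * e / (2 * (c + e))"
  have \<delta>: "0 < \<delta>" "0 < \<delta>'" using \<gamma> e c by (auto simp: \<delta>_def \<delta>'_def)
  have \<delta>'c: "2 * \<delta>' * (c + e) = \<gamma> * e"
  proof -
    have *: "2 * (w / (2 * s)) * s = w" if "0 < s" for w s :: real using that by simp
    show ?thesis unfolding \<delta>'_def by (rule *) (use c e in simp)
  qed
  \<comment> \<open>The roundings are such that a value of at least \<open>(c + e) * n\<close>
    reaches \<open>m n\<close>, while one of at most \<open>(c - e) * n\<close> stays strictly below
    \<open>l n\<close>.\<close>
  define m where "m n = nat \<lceil>(c + e) * real n\<rceil>" for n
  define l where "l n = nat \<lfloor>(c - e) * real n\<rfloor> + 1" for n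
  have m: "(c + e) * real n \<le> real (m n)" for n unfolding m_def by linarith
  have l: "(c - e) * real n < real (l n)" "real (l n) \<le> (c - e) * real n + 1" for n
  proof -
    have "0 \<le> (c - e) * real n" using e by simp
    then show "(c - e) * real n < real (l n)" "real (l n) \<le> (c - e) * real n + 1" unfolding l_def by linarith+
  qed
  define B where "B n = {x. 0 \<le> x \<and> x < 1 \<and> (beta_map \<beta> ^^ n) x < exp (- \<delta> * real n)}" for n
  define D where "D k = {x. 0 \<le> x \<and> x < 1 \<and> \<delta>' * real k \<le> \<bar>birkhoff_ln k x - \<gamma> * real k\<bar>}" for k
  define R where "R n = {x. 0 \<le> x \<and> x < 1 \<and> (\<exists>j\<le>l n. (gauss_map ^^ j) x < exp (- \<delta> * real n) \<or>
     1 - exp (- \<delta> * real n) < (gauss_map ^^ j) x)}" for n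
  have "exp_small B" unfolding B_def[abs_def] by (rule exp_small_beta_iter[OF b \<delta>(1)])
  moreover have D: "exp_small D" unfolding D_def[abs_def] \<gamma>_def by (rule exp_small_birkhoff_ln[OF \<delta>(2)])
  moreover have "exp_small (\<lambda>n. D (m n))" using c e m by (intro exp_small_reindex[OF D, of "c + e"]) auto
  moreover have "exp_small (\<lambda>n. D (l n))"
    using e l(1) by (intro exp_small_reindex[OF D, of "c - e"]) (auto intro: less_imp_le)
  moreover have "exp_small R" unfolding R_def[abs_def]
    using e l(2) by (intro exp_small_gauss_near_ends[OF \<delta>(1), of "c - e"]) auto
  ultimately have small: "exp_small (\<lambda>n. (B n \<union> D (m n)) \<union> (D (l n) \<union> R n))" by (intro exp_small_Un)
  \<comment> \<open>From here on \<open>\<delta> * n\<close> dominates the additive constants of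
    both cases; the summand 1 ensures that \<open>n\<close> is positive.\<close>
  define n0 where "n0 = nat \<lceil>(2 * (\<gamma> + \<delta>') + ln 4) / \<delta>\<rceil> + 1"
  show ?thesis
  proof (rule exp_small_eventually_subset[OF small, of n0])
    show "deviation_set \<beta> \<epsilon> n \<in> sets borel" for n by (rule deviation_set_borel)
    show "deviation_set \<beta> \<epsilon> n \<subseteq> {0..<1}" for n by (auto simp: deviation_set_def)
    fix n assume n: "n0 \<le> n"
    then have n1: "0 < real n" by (simp add: n0_def)
    have "(2 * (\<gamma> + \<delta>') + ln 4) / \<delta> \<le> real n" using n unfolding n0_def by linarith
    then have big: "2 * (\<gamma> + \<delta>') + ln 4 \<le> \<delta> * real n" using \<delta>(1) by (simp add: field_simps)
    show "deviation_set \<beta> \<epsilon> n \<subseteq> (B n \<union> D (m n)) \<union> (D (l n) \<union> R n)"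
    proof (rule subsetI, rule ccontr)
      fix x assume dev: "x \<in> deviation_set \<beta> \<epsilon> n" and out: "x \<notin> (B n \<union> D (m n)) \<union> (D (l n) \<union> R n)"
      let ?k = "cf_digits_known \<beta> n x"
      have x: "x \<in> {0..<1}" "x \<notin> \<rat>" and "\<epsilon> \<le> \<bar>real ?k / real n - c\<bar>"
        using dev unfolding deviation_set_def c_eq by auto
      then have "e \<le> \<bar>real ?k / real n - c\<bar>" using e by simp
      then have cases: "c + e \<le> real ?k / real n \<or> real ?k / real n \<le> c - e" by linarith
      have x01: "0 \<le> x" "x < 1" using x by auto
      have t: "exp (- (\<delta> * real n)) \<le> (beta_map \<beta> ^^ n) x" using out x01 by (auto simp: B_def not_less)
      then have pos: "0 < (beta_map \<beta> ^^ n) x" by (rule less_le_trans[OF exp_gt_zero])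
      have Dm: "\<bar>birkhoff_ln (m n) x - \<gamma> * real (m n)\<bar> < \<delta>' * real (m n)"
        and Dl: "\<bar>birkhoff_ln (l n) x - \<gamma> * real (l n)\<bar> < \<delta>' * real (l n)"
        using out x01 by (auto simp: D_def not_le)
      have far: "exp (- (\<delta> * real n)) \<le> (gauss_map ^^ j) x \<and> (gauss_map ^^ j) x \<le> 1 - exp (- (\<delta> * real n))"
        if "j \<le> l n" for j using out x01 that by (auto simp: R_def not_less)
      have ln4: "ln 2 \<le> ln (4 :: real)" "0 \<le> ln (4 :: real)" by auto
      from cases show False
      proof
        assume "c + e \<le> real ?k / real n"
        then have "(c + e) * real n \<le> real ?k" using n1 by (simp add: field_simps)
        then have "m n \<le> ?k" unfolding m_def by linarith
        then have "2 * birkhoff_ln (m n) x \<le> ln 2 + real n * ln \<beta> + \<delta> * real n"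
          using le_cf_digits_known_iff[OF b x pos] by (intro birkhoff_ln_le[OF b x t]) blast
        moreover have "(\<gamma> - \<delta>') * real (m n) < birkhoff_ln (m n) x" using Dm by (simp add: left_diff_distrib abs_less_iff)
        moreover have "(\<gamma> - \<delta>') * ((c + e) * real n) \<le> (\<gamma> - \<delta>') * real (m n)"
        proof (rule mult_left_mono[OF m])
          have "\<delta>' \<le> \<gamma>" unfolding \<delta>'_def using \<gamma> c e by (simp add: divide_simps)
          then show "0 \<le> \<gamma> - \<delta>'" by simp
        qed
        moreover have "2 * ((\<gamma> - \<delta>') * ((c + e) * real n)) = real n * ln \<beta> + 2 * \<delta> * real n"
        proof -
          have "2 * ((\<gamma> - \<delta>') * ((c + e) * real n)) = (2 * \<gamma> * c + 2 * \<gamma> * e - 2 * \<delta>' * (c + e)) * real n"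
            by (simp add: algebra_simps)
          then show ?thesis unfolding \<delta>'c c(2) by (simp add: \<delta>_def algebra_simps)
        qed
        ultimately have "\<delta> * real n < ln 2" by linarith
        then show False using big ln4 \<gamma> \<delta> unfolding distrib_left by linarith
      next
        assume "real ?k / real n \<le> c - e"
        then have "real ?k \<le> (c - e) * real n" using n1 by (simp add: field_simps)
        then have "?k < l n" using l(1)[of n] by linarith
        then have "real n * ln \<beta> - \<delta> * real n - ln 4 \<le> 2 * birkhoff_ln (l n) x"
          using le_cf_digits_known_iff[OF b x pos] by (intro birkhoff_ln_ge[OF b x far]) (auto simp: not_le[symmetric])
        moreover have "birkhoff_ln (l n) x < (\<gamma> + \<delta>') * real (l n)" using Dl by (simp add: distrib_right abs_less_iff)
        moreover have "(\<gamma> + \<delta>') * real (l n) \<le> (\<gamma> + \<delta>') * ((c - e) * real n + 1)"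
          using \<gamma> \<delta> l(2) by (intro mult_left_mono) auto
        moreover have "2 * ((\<gamma> + \<delta>') * ((c - e) * real n + 1)) \<le> real n * ln \<beta> - 2 * \<delta> * real n + 2 * (\<gamma> + \<delta>')"
        proof -
          have "2 * ((\<gamma> + \<delta>') * ((c - e) * real n + 1)) =
            (2 * \<gamma> * c - 2 * \<gamma> * e + 2 * \<delta>' * (c + e) - 4 * \<delta>' * e) * real n + 2 * (\<gamma> + \<delta>')"
            by (simp add: algebra_simps)
          also have "\<dots> = real n * ln \<beta> - 2 * \<delta> * real n - 4 * \<delta>' * e * real n + 2 * (\<gamma> + \<delta>')"
            unfolding \<delta>'c c(2) by (simp add: \<delta>_def algebra_simps)
          also have "\<dots> \<le> real n * ln \<beta> - 2 * \<delta> * real n + 2 * (\<gamma> + \<delta>')" using \<delta> e by simp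
          finally show ?thesis .
        qed
        ultimately have "\<delta> * real n < 2 * (\<gamma> + \<delta>') + ln 4" by linarith
        then show False using big by linarith
      qed
    qed
  qed
qed

theorem theorem1p1:
  fixes \<beta> \<epsilon> :: real
  assumes "\<beta> > 1" and "\<epsilon> > 0"
  shows "\<exists>A>0. \<exists>\<alpha>>0. \<forall>n\<ge>1.
           deviation_set \<beta> \<epsilon> n \<in> lmeasurable \<and>
           measure lebesgue (deviation_set \<beta> \<epsilon> n) \<le> A * exp (- \<alpha> * real n)"
proof -
  obtain A \<alpha> where A: "0 < A" "0 < \<alpha>"
    and le: "\<And>n. emeasure lborel (deviation_set \<beta> \<epsilon> n) \<le> ennreal (A * exp (- \<alpha> * real n))"
    using deviation_set_exp_small[OF assms] by (auto simp: exp_small_def)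
  have "deviation_set \<beta> \<epsilon> n \<in> lmeasurable \<and>
      measure lebesgue (deviation_set \<beta> \<epsilon> n) \<le> A * exp (- \<alpha> * real n)" for n
  proof
    have em: "emeasure lebesgue (deviation_set \<beta> \<epsilon> n) \<le> ennreal (A * exp (- \<alpha> * real n))"
      using le[of n] deviation_set_borel[of \<beta> \<epsilon> n] by simp
    then show "deviation_set \<beta> \<epsilon> n \<in> lmeasurable"
      using deviation_set_borel[of \<beta> \<epsilon> n] by (intro fmeasurableI) (auto intro: le_less_trans)
    show "measure lebesgue (deviation_set \<beta> \<epsilon> n) \<le> A * exp (- \<alpha> * real n)"
      unfolding measure_def using A em by (intro enn2real_leI) auto
  qed
  then show ?thesis using A by blast
qed

end
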